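(* Let $\mathcal U$ and $\mathcal X$ be complex Hilbert spaces, let $A\in\mathcal B(\mathcal X)$, $B\in\mathcal B(\mathcal U,\mathcal X)$, $C\in\mathcal B(\mathcal X,\mathcal U)$, $D\in\mathcal B(\mathcal U)$, and consider the $\mathcal B(\mathcal U)$-valued function $$G(z)=I+F(z),\qquad F(z)=D+zC(I-zA)^{-1}B,\qquad \|F\|_{\infty,\mathbb T}<1 .$$ Assume that $A$ is dichotomous and that $I+D$ is invertible, and let $I+D=D_1D_2$ be any factorization with $D_1,D_2\in\mathcal B(\mathcal U)$ invertible. Let $A^\times:=A-B(I+D)^{-1}C$ (which is dichotomous), and let $(\mathcal X_-,\mathcal X_+)$ and $(\mathcal X_-^\times,\mathcal X_+^\times)$ be the dichotomous pairs of $A$ and $A^\times$, respectively. Then $$\mathcal X=\mathcal X_-^\times\dotplus\mathcal X_+ .$$ Write $\Pi_\ell$ for the projection in $\mathcal X$ onto $\mathcal X_-^\times$ along $\mathcal X_+$. Then $G(z)=W_+(z)W_-(z)$, where $$\begin{aligned} W_+(z)&:=D_1+zC(I-zA)^{-1}(I-\Pi_\ell)BD_2^{-1},\\ W_-(z)&:=D_2+zD_1^{-1}C\Pi_\ell(I-zA)^{-1}B,\qquad z\in\rho(A)^{-1}\cup\{0\},\end{aligned}$$ with inverses given by $$\begin{aligned} W_+(z)^{-1}&=D_1^{-1}-zD_1^{-1}C(I-\Pi_\ell)(I-zA^\times)^{-1}BD_2^{-1}D_1^{-1},\\ W_-(z)^{-1}&=D_2^{-1}-zD_2^{-1}D_1^{-1}C(I-zA^\times)^{-1}\Pi_\ell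 BD_2^{-1},\qquad z\in\rho(A^\times)^{-1}\cup\{0\}.\end{aligned}$$ The functions $W_+(z)$ and $W_+(z)^{-1}$ extend analytically to functions on a neighborhood of the closed unit disc $\overline{\mathbb D}$, while $W_-(z)$ and $W_-(z)^{-1}$ extend analytically to functions on a neighborhood of $\overline{\mathbb E}$.
   Context: $\mathcal B(\mathcal X,\mathcal Y)$ denotes the bounded linear operators from $\mathcal X$ to $\mathcal Y$, and $\mathcal B(\mathcal X)=\mathcal B(\mathcal X,\mathcal X)$. An operator is invertible when it has a bounded inverse. $\mathbb T$ is the complex unit circle, $\mathbb D$ the open unit disc, $\mathbb E:=\mathbb C\setminus\overline{\mathbb D}$, and $\overline{\mathbb E}$ its closure (the closed complement of $\mathbb D$). $\sigma(A)$ and $\rho(A)$ are the spectrum and resolvent set; $\rho(A)^{-1}\cup\{0\}$ denotes the set of all $z\in\mathbb C$ such that $I-zA$ is invertible. $\|F\|_{\infty,\mathbb T}:=\max_{z\in\mathbb T}\|F(z)\|$. An operator $A\in\mathcal B(\mathcal X)$ is dichotomous if $\sigma(A)\cap\mathbb T=\emptyset$. Its dichotomous pair $(\mathcal X_-,\mathcal X_+)$ consists of the spectral subspaces of $A$ corresponding to $\mathbb E$ and $\mathbb D$, respectively: $\mathcal X_+=\operatorname{Im}P_+$ and $\mathcal X_-=\operatorname{Ker}P_+$ with $P_+=\frac1{2\pi i}\int_{\mathbb T}(zI-A)^{-1}\,dz$ (counterclockwise). Equivalently, $\mathcal X=\mathcal X_-\dotplus\mathcal X_+$, both subspaces are closed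 and $A$-invariant, $\sigma(A|_{\mathcal X_-})\subset\mathbb E$ and $\sigma(A|_{\mathcal X_+})\subset\mathbb D$. The symbol $\dotplus$ denotes a (not necessarily orthogonal) direct sum of closed subspaces. The functions $W_\pm$ are defined on $\rho(A)^{-1}\cup\{0\}$, where the factorization $G=W_+W_-$ holds. The formulas for the inverses give the inverse operators of $W_\pm(z)$ at points $z$ in $(\rho(A)^{-1}\cup\{0\})\cap(\rho(A^\times)^{-1}\cup\{0\})$, and they define the functions denoted $W_\pm(z)^{-1}$ on the whole of $\rho(A^\times)^{-1}\cup\{0\}$. *)

theory Defs
  imports "HOL-Analysis.Analysis"
begin

section \<open>Complex Hilbert spaces\<close>

text \<open>
  The library has only the real classes. The scalar multiplication by complex numbers extends
  the real one, and the norm of \<^class>\<open>real_normed_vector\<close> is the one induced by the inner product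
  (which is linear in its first argument).
\<close>

class complex_vector = real_vector +
  fixes scaleC :: "complex \<Rightarrow> 'a \<Rightarrow> 'a" (infixr "*\<^sub>C" 75)
  assumes scaleC_add_right: "c *\<^sub>C (x + y) = c *\<^sub>C x + c *\<^sub>C y"
    and scaleC_add_left: "(c + d) *\<^sub>C x = c *\<^sub>C x + d *\<^sub>C x"
    and scaleC_scaleC: "c *\<^sub>C (d *\<^sub>C x) = (c * d) *\<^sub>C x"
    and scaleC_of_real: "complex_of_real r *\<^sub>C x = r *\<^sub>R x"

class complex_normed_vector = real_normed_vector + complex_vector +
  assumes norm_scaleC: "norm (c *\<^sub>C x) = cmod c * norm x"

class complex_inner = complex_normed_vector +
  fixes cinner :: "'a \<Rightarrow> 'a \<Rightarrow> complex"
  assumes cinner_commute: "cinner x y = cnj (cinner y x)"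
    and cinner_add_left: "cinner (x + y) z = cinner x z + cinner y z"
    and cinner_scaleC_left: "cinner (c *\<^sub>C x) y = c * cinner x y"
    and cinner_self: "cinner x x = complex_of_real ((norm x)\<^sup>2)"

class complex_hilbert_space = complex_inner + banach

lemma vector_space_scaleC: "vector_space (scaleC :: complex \<Rightarrow> 'a \<Rightarrow> 'a::complex_vector)"
proof
  show "1 *\<^sub>C x = x" for x :: 'a
    using scaleC_of_real[of 1 x] by simp
qed (auto simp: scaleC_add_right scaleC_add_left scaleC_scaleC)

interpretation complex_vector: vector_space "scaleC :: complex \<Rightarrow> 'a \<Rightarrow> 'a::complex_vector"
  by (rule vector_space_scaleC)

instantiation complex :: complex_hilbert_space
begin

definition scaleC_complex :: "complex \<Rightarrow> complex \<Rightarrow> complex"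
  where "scaleC_complex c x = c * x"

definition cinner_complex :: "complex \<Rightarrow> complex \<Rightarrow> complex"
  where "cinner_complex x y = x * cnj y"

instance
proof
  fix x :: complex
  show "cinner x x = complex_of_real ((norm x)\<^sup>2)"
    unfolding cinner_complex_def by (rule complex_norm_square[symmetric])
qed (simp_all add: scaleC_complex_def cinner_complex_def ring_distribs norm_mult
  scaleR_conv_of_real mult.assoc)

end


section \<open>Bounded operators\<close>

lemma bounded_linear_scaleC_right:
  "bounded_linear ((*\<^sub>C) c :: 'a \<Rightarrow> 'a::complex_normed_vector)"
proof (rule bounded_linear_intro[where K = "cmod c"])
  show "c *\<^sub>C (r *\<^sub>R x) = r *\<^sub>R (c *\<^sub>C x)" for r and x :: 'a
    by (simp flip: scaleC_of_real add: scaleC_scaleC mult.commute)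
qed (auto simp: scaleC_add_right norm_scaleC mult.commute)

instantiation blinfun :: (real_normed_vector, complex_normed_vector) complex_normed_vector
begin

lift_definition scaleC_blinfun :: "complex \<Rightarrow> ('a \<Rightarrow>\<^sub>L 'b) \<Rightarrow> ('a \<Rightarrow>\<^sub>L 'b)"
  is "\<lambda>c f x. c *\<^sub>C f x"
  by (rule bounded_linear_compose[OF bounded_linear_scaleC_right])

instance
proof
  fix c d :: complex and r :: real and S T :: "'a \<Rightarrow>\<^sub>L 'b"
  show "c *\<^sub>C (S + T) = c *\<^sub>C S + c *\<^sub>C T" by transfer (simp add: scaleC_add_right)
  show "(c + d) *\<^sub>C S = c *\<^sub>C S + d *\<^sub>C S" by transfer (simp add: scaleC_add_left)
  show "c *\<^sub>C d *\<^sub>C S = (c * d) *\<^sub>C S" by transfer (simp add: scaleC_scaleC)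
  show "complex_of_real r *\<^sub>C S = r *\<^sub>R S" by transfer (simp add: scaleC_of_real)
  have le: "norm (c *\<^sub>C S) \<le> cmod c * norm S" for c :: complex and S :: "'a \<Rightarrow>\<^sub>L 'b"
  proof (rule norm_blinfun_bound)
    show "norm (blinfun_apply (c *\<^sub>C S) x) \<le> cmod c * norm S * norm x" for x
      by (simp add: scaleC_blinfun.rep_eq norm_scaleC mult.assoc mult_left_mono norm_blinfun)
  qed simp
  show "norm (c *\<^sub>C S) = cmod c * norm S"
  proof (cases "c = 0")
    case False
    have "inverse c *\<^sub>C (c *\<^sub>C S) = S"
      using False by transfer (simp add: scaleC_scaleC)
    then have "norm S \<le> cmod (inverse c) * norm (c *\<^sub>C S)"
      using le[of "inverse c" "c *\<^sub>C S"] by simp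
    then have "cmod c * norm S \<le> norm (c *\<^sub>C S)"
      using False by (simp add: norm_divide field_simps)
    then show ?thesis using le[of c S] by simp
  qed (use le[of 0 S] in simp)
qed

end

text \<open>
  The operators of \<open>B(X,Y)\<close>: elements of \<open>'a \<Rightarrow>\<^sub>L 'b\<close> are only real linear, so complex homogeneity
  has to be imposed.
\<close>

definition bounded_ops :: "('a::complex_normed_vector \<Rightarrow>\<^sub>L 'b::complex_normed_vector) set"
  where "bounded_ops = {T :: 'a \<Rightarrow>\<^sub>L 'b. \<forall>c x. T (c *\<^sub>C x) = c *\<^sub>C T x}"

definition is_op_inverse ::
  "('a::complex_normed_vector \<Rightarrow>\<^sub>L 'b::complex_normed_vector) \<Rightarrow> ('b \<Rightarrow>\<^sub>L 'a) \<Rightarrow> bool"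
  where "is_op_inverse T S \<longleftrightarrow>
    S \<in> bounded_ops \<and> S o\<^sub>L T = id_blinfun \<and> T o\<^sub>L S = id_blinfun"

definition op_invertible :: "('a::complex_normed_vector \<Rightarrow>\<^sub>L 'b::complex_normed_vector) \<Rightarrow> bool"
  where "op_invertible T \<longleftrightarrow> (\<exists>S. is_op_inverse T S)"

definition op_inv :: "('a::complex_normed_vector \<Rightarrow>\<^sub>L 'b::complex_normed_vector) \<Rightarrow> ('b \<Rightarrow>\<^sub>L 'a)"
  where "op_inv T = (THE S. is_op_inverse T S)"

definition op_spectrum :: "('a::complex_normed_vector \<Rightarrow>\<^sub>L 'a) \<Rightarrow> complex set"
  where "op_spectrum A = {z. \<not> op_invertible (z *\<^sub>C id_blinfun - A)}"

text \<open>The set \<open>\<rho>(A)\<^sup>-\<^sup>1 \<union> {0}\<close>.\<close>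

definition inv_resolvent_set :: "('a::complex_normed_vector \<Rightarrow>\<^sub>L 'a) \<Rightarrow> complex set"
  where "inv_resolvent_set A = {z. op_invertible (id_blinfun - z *\<^sub>C A)}"


section \<open>Dichotomous operators\<close>

definition dichotomous :: "('a::complex_hilbert_space \<Rightarrow>\<^sub>L 'a) \<Rightarrow> bool"
  where "dichotomous A \<longleftrightarrow> op_spectrum A \<inter> sphere 0 1 = {}"

text \<open>
  The contour integral over the counterclockwise unit circle \<open>z = e\<^sup>i\<^sup>t\<close>, \<open>dz = i e\<^sup>i\<^sup>t dt\<close>
  (the contour integral of the library is restricted to complex-valued integrands).
\<close>

definition circle_integral :: "(complex \<Rightarrow> 'b::complex_normed_vector) \<Rightarrow> 'b"
  where "circle_integral f = integral {0..2 * pi} (\<lambda>t. (\<i> * cis t) *\<^sub>C f (cis t))"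

definition riesz_projection :: "('a::complex_hilbert_space \<Rightarrow>\<^sub>L 'a) \<Rightarrow> ('a \<Rightarrow>\<^sub>L 'a)"
  where "riesz_projection A =
    (1 / (2 * of_real pi * \<i>)) *\<^sub>C circle_integral (\<lambda>z. op_inv (z *\<^sub>C id_blinfun - A))"

text \<open>The dichotomous pair of \<open>A\<close> is \<open>(X_minus A, X_plus A)\<close>.\<close>

definition X_plus :: "('a::complex_hilbert_space \<Rightarrow>\<^sub>L 'a) \<Rightarrow> 'a set"
  where "X_plus A = range (blinfun_apply (riesz_projection A))"

definition X_minus :: "('a::complex_hilbert_space \<Rightarrow>\<^sub>L 'a) \<Rightarrow> 'a set"
  where "X_minus A = {x. riesz_projection A x = 0}"

text \<open>\<open>M\<close> and \<open>N\<close> are closed subspaces and the whole space is their direct sum.\<close>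

definition direct_sum_decomp :: "'a::complex_normed_vector set \<Rightarrow> 'a set \<Rightarrow> bool"
  where "direct_sum_decomp M N \<longleftrightarrow>
    complex_vector.subspace M \<and> closed M \<and> complex_vector.subspace N \<and> closed N \<and>
    M \<inter> N = {0} \<and> (\<forall>x. \<exists>m\<in>M. \<exists>n\<in>N. x = m + n)"

definition is_projection_along ::
  "('a::complex_normed_vector \<Rightarrow>\<^sub>L 'a) \<Rightarrow> 'a set \<Rightarrow> 'a set \<Rightarrow> bool"
  where "is_projection_along P M N \<longleftrightarrow>
    P \<in> bounded_ops \<and> P o\<^sub>L P = P \<and> range (blinfun_apply P) = M \<and> {x. P x = 0} = N"

definition projection_along :: "'a::complex_normed_vector set \<Rightarrow> 'a set \<Rightarrow> ('a \<Rightarrow>\<^sub>L 'a)"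
  where "projection_along M N = (THE P. is_projection_along P M N)"


section \<open>Operator functions\<close>

text \<open>
  The supremum of a continuous function on the compact unit circle is its maximum. For an
  unbounded \<open>F\<close> the value is meaningless.
\<close>

definition sup_norm_circle :: "(complex \<Rightarrow> 'b::complex_normed_vector) \<Rightarrow> real"
  where "sup_norm_circle F = (SUP z\<in>sphere 0 1. norm (F z))"

definition vec_analytic_on :: "(complex \<Rightarrow> 'b::complex_normed_vector) \<Rightarrow> complex set \<Rightarrow> bool"
  where "vec_analytic_on f U \<longleftrightarrow>
    open U \<and> (\<forall>z\<in>U. \<exists>d. (f has_derivative (\<lambda>h. h *\<^sub>C d)) (at z))"

text \<open>
  \<open>f\<close>, which is regarded as defined on \<open>S\<close> only, extends analytically to an open neighbourhood
  of \<open>K\<close> in the complex plane.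
\<close>

definition extends_analytically ::
  "(complex \<Rightarrow> 'b::complex_normed_vector) \<Rightarrow> complex set \<Rightarrow> complex set \<Rightarrow> bool"
  where "extends_analytically f S K \<longleftrightarrow>
    (\<exists>U g. K \<subseteq> U \<and> vec_analytic_on g U \<and> (\<forall>z\<in>U \<inter> S. g z = f z))"

end

theory Submission
  imports Defs
begin

text \<open>
  On the circle the resolvent has the two-sided expansion
  \<open>(I - zA)\<^sup>-\<^sup>1 = \<Sum>\<^sub>n\<^sub>\<ge>\<^sub>0 z\<^sup>n A\<^sup>n P - \<Sum>\<^sub>n\<^sub>\<ge>\<^sub>1 z\<^sup>-\<^sup>n Q\<^sup>n\<close>, where \<open>P\<close> is the Riesz projection and \<open>Q\<close> inverts \<open>A\<close>
  on \<open>ker P\<close>. Hence \<open>F\<close> has absolutely summable Fourier coefficients, and the Toeplitz operator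
  \<open>T\<close> built from them on one-sided sequences has \<open>\<ell>\<^sup>2\<close>-norm below 1, because \<open>F\<close> is a strict
  contraction on the circle; so \<open>I + T\<close> is invertible.

  Bounded solutions of \<open>k\<^sub>m = A\<^sup>\<times> k\<^sub>m\<^sub>+\<^sub>1\<close> start in \<open>X\<^sub>-\<^sup>\<times>\<close>, and with \<open>u\<^sub>m = (I + D)\<^sup>-\<^sup>1 C k\<^sub>m\<^sub>+\<^sub>1\<close> they are the
  bounded solutions of \<open>k\<^sub>m = A k\<^sub>m\<^sub>+\<^sub>1 - B u\<^sub>m\<close>. Eliminating \<open>k\<close> turns the latter into the equation
  \<open>u + T u = g\<close>, where \<open>g\<close> depends only on the component of \<open>k\<^sub>0\<close> in \<open>X\<^sub>-\<close>. Solvability for every \<open>g\<close>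
  gives \<open>X = X\<^sub>-\<^sup>\<times> + X\<^sub>+\<close>, and uniqueness for \<open>g = 0\<close> gives \<open>X\<^sub>-\<^sup>\<times> \<inter> X\<^sub>+ = 0\<close>. The norm bound for the solution \<open>u\<close>
  shows that the projection is bounded, so no closed graph theorem is needed. The formulas for the
  factors follow from \<open>B (I + D)\<^sup>-\<^sup>1 C = A - A\<^sup>\<times>\<close> and the invariance of \<open>X\<^sub>-\<^sup>\<times>\<close> and \<open>X\<^sub>+\<close>.
\<close>

section \<open>Bounded operators and their inverses\<close>

declare scaleC_blinfun.rep_eq [simp]

lemma bounded_opsD: "T \<in> bounded_ops \<Longrightarrow> blinfun_apply T (c *\<^sub>C x) = c *\<^sub>C blinfun_apply T x"
  by (simp add: bounded_ops_def)

lemma scaleC_scaleR: "c *\<^sub>C (r *\<^sub>R x) = r *\<^sub>R (c *\<^sub>C (x::'a::complex_normed_vector))"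
  by (simp flip: scaleC_of_real add: scaleC_scaleC mult.commute)

lemma bounded_ops_id [simp, intro]: "id_blinfun \<in> bounded_ops"
  and bounded_ops_zero [simp, intro]: "0 \<in> bounded_ops"
  and bounded_ops_add [simp, intro]: "S \<in> bounded_ops \<Longrightarrow> T \<in> bounded_ops \<Longrightarrow> S + T \<in> bounded_ops"
  and bounded_ops_diff [simp, intro]: "S \<in> bounded_ops \<Longrightarrow> T \<in> bounded_ops \<Longrightarrow> S - T \<in> bounded_ops"
  and bounded_ops_uminus [simp, intro]: "S \<in> bounded_ops \<Longrightarrow> - S \<in> bounded_ops"
  and bounded_ops_scaleC [simp, intro]: "S \<in> bounded_ops \<Longrightarrow> c *\<^sub>C S \<in> bounded_ops"
  and bounded_ops_compose [simp, intro]: "U \<in> bounded_ops \<Longrightarrow> V \<in> bounded_ops \<Longrightarrow> U o\<^sub>L V \<in> bounded_ops"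
  by (auto simp: bounded_ops_def blinfun.bilinear_simps scaleC_add_right scaleC_scaleC mult.commute
      complex_vector.scale_right_diff_distrib complex_vector.scale_minus_right scaleC_scaleR)

lemma is_op_inverse_apply:
  assumes "is_op_inverse T S"
  shows "blinfun_apply S (blinfun_apply T x) = x" "blinfun_apply T (blinfun_apply S y) = y"
proof -
  have "blinfun_apply (S o\<^sub>L T) x = x" "blinfun_apply (T o\<^sub>L S) y = y"
    using assms by (simp_all add: is_op_inverse_def)
  then show "blinfun_apply S (blinfun_apply T x) = x" "blinfun_apply T (blinfun_apply S y) = y"
    by simp_all
qed

text \<open>The inverse of a complex homogeneous operator is itself homogeneous, so the two
  pointwise identities already suffice.\<close>

lemma is_op_inverseI:
  assumes T: "T \<in> bounded_ops" and 1: "\<And>x. blinfun_apply S (blinfun_apply T x) = x"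
    and 2: "\<And>y. blinfun_apply T (blinfun_apply S y) = y"
  shows "is_op_inverse T S"
  unfolding is_op_inverse_def
proof (intro conjI)
  have "S (c *\<^sub>C x) = c *\<^sub>C S x" for c x
    using 1[of "c *\<^sub>C S x"] by (simp add: bounded_opsD[OF T] 2)
  then show "S \<in> bounded_ops" by (simp add: bounded_ops_def)
qed (auto intro!: blinfun_eqI simp: 1 2)

lemma is_op_inverse_unique: "is_op_inverse T S \<Longrightarrow> is_op_inverse T S' \<Longrightarrow> S = S'"
  by (metis blinfun_eqI is_op_inverse_apply)

lemma op_inv_eqI: "is_op_inverse T S \<Longrightarrow> op_inv T = S"
  unfolding op_inv_def by (blast intro: is_op_inverse_unique)

lemma is_op_inverse_op_inv: "op_invertible T \<Longrightarrow> is_op_inverse T (op_inv T)"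
  by (metis op_inv_eqI op_invertible_def)

lemma op_invertibleI: "is_op_inverse T S \<Longrightarrow> op_invertible T"
  by (auto simp: op_invertible_def)

lemma op_inv_bounded_ops: "op_invertible T \<Longrightarrow> op_inv T \<in> bounded_ops"
  using is_op_inverse_op_inv is_op_inverse_def by blast

lemma op_inv_apply:
  assumes "op_invertible T"
  shows "blinfun_apply (op_inv T) (blinfun_apply T x) = x"
    and "blinfun_apply T (blinfun_apply (op_inv T) y) = y"
  using is_op_inverse_apply[OF is_op_inverse_op_inv[OF assms]] by auto

lemma is_op_inverse_compose:
  assumes "is_op_inverse T S" "is_op_inverse T' S'"
  shows "is_op_inverse (T o\<^sub>L T') (S' o\<^sub>L S)"
  using assms unfolding is_op_inverse_def
  by (auto intro!: blinfun_eqI simp: is_op_inverse_apply[OF assms(1)] is_op_inverse_apply[OF assms(2)])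

lemma is_op_inverse_scaleC:
  assumes "is_op_inverse T S" "T \<in> bounded_ops" "c \<noteq> 0"
  shows "is_op_inverse (c *\<^sub>C T) (inverse c *\<^sub>C S)"
proof -
  have "S \<in> bounded_ops" using assms by (simp add: is_op_inverse_def)
  then show ?thesis
    using assms(2,3) by (intro is_op_inverseI)
      (auto simp: bounded_opsD scaleC_scaleC is_op_inverse_apply[OF assms(1)])
qed

section \<open>Powers of an operator and the Neumann series\<close>

primrec opow :: "('a::real_normed_vector \<Rightarrow>\<^sub>L 'a) \<Rightarrow> nat \<Rightarrow> 'a \<Rightarrow>\<^sub>L 'a" where
  "opow T 0 = id_blinfun"
| "opow T (Suc n) = T o\<^sub>L opow T n"

lemma opow_commute: "blinfun_apply (opow T n) (blinfun_apply T x) = blinfun_apply T (blinfun_apply (opow T n) x)"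
  by (induction n) auto

lemma opow_add_apply: "blinfun_apply (opow T (m + n)) x = opow T m (opow T n x)"
  by (induction m) auto

lemma opow_add: "opow T (m + n) = opow T m o\<^sub>L opow T n"
  by (auto intro!: blinfun_eqI simp: opow_add_apply)

lemma opow_bounded_ops [simp, intro]: "T \<in> bounded_ops \<Longrightarrow> opow T n \<in> bounded_ops"
  by (induction n) auto

lemma opow_scaleC:
  assumes "T \<in> bounded_ops"
  shows "opow (z *\<^sub>C T) n = z ^ n *\<^sub>C opow T n"
  by (induction n) (auto intro!: blinfun_eqI simp: bounded_opsD[OF assms] scaleC_scaleC)

text \<open>Once some power has norm at most 1/2, submultiplicativity bounds each partial sum by a
  constant plus half of itself.\<close>

lemma opow_summable:
  fixes T :: "'a::real_normed_vector \<Rightarrow>\<^sub>L 'a"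
  assumes "(\<lambda>n. norm (opow T n)) \<longlonglongrightarrow> 0"
  shows "summable (\<lambda>n. norm (opow T n))"
proof -
  obtain N where N: "norm (opow T N) \<le> 1/2"
    using order_tendstoD(2)[OF assms, of "1/2"] unfolding eventually_sequentially
    by (meson less_imp_le order_refl zero_less_divide_1_iff zero_less_numeral)
  define K where "K = (\<Sum>n<N. norm (opow T n))"
  have "(\<Sum>n<m. norm (opow T n)) \<le> 2 * K" for m
  proof -
    have "(\<Sum>n<m. norm (opow T n)) \<le> (\<Sum>n<N + m. norm (opow T n))"
      by (rule sum_mono2) auto
    also have "\<dots> = K + (\<Sum>n<m. norm (opow T (N + n)))"
      unfolding K_def by (induction m) auto
    also have "(\<Sum>n<m. norm (opow T (N + n))) \<le> (\<Sum>n<m. 1/2 * norm (opow T n))"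
    proof (rule sum_mono)
      fix n
      have "norm (opow T (N + n)) \<le> norm (opow T N) * norm (opow T n)"
        unfolding opow_add by (rule norm_blinfun_compose)
      also have "\<dots> \<le> 1/2 * norm (opow T n)"
        using N by (intro mult_right_mono) auto
      finally show "norm (opow T (N + n)) \<le> 1/2 * norm (opow T n)" .
    qed
    finally show ?thesis by (simp add: sum_divide_distrib[symmetric])
  qed
  then show ?thesis
    by (intro summableI_nonneg_bounded) auto
qed

lemma summable_apply:
  fixes f :: "nat \<Rightarrow> 'a::real_normed_vector \<Rightarrow>\<^sub>L 'b::real_normed_vector"
  assumes "summable f"
  shows "summable (\<lambda>n. blinfun_apply (f n) x)"
    and "(\<Sum>n. blinfun_apply (f n) x) = blinfun_apply (suminf f) x"
  using assms by (simp_all add: bounded_linear.summable[OF blinfun.bounded_linear_left]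
    bounded_linear.suminf[OF blinfun.bounded_linear_left])

text \<open>Formulated through summable powers because it is applied to \<open>A o\<^sub>L P\<close>
  and \<open>Q\<close>, which may have norm above 1.\<close>

lemma neumann_series:
  fixes T :: "'a::{complex_normed_vector, banach} \<Rightarrow>\<^sub>L 'a"
  assumes T: "T \<in> bounded_ops" and sm: "summable (\<lambda>n. norm (opow T n))"
  shows "is_op_inverse (id_blinfun - T) (\<Sum>n. opow T n)"
proof -
  have s: "summable (opow T)" using sm by (rule summable_norm_cancel)
  define S where "S = (\<Sum>n. opow T n)"
  have split: "S x = x + T (S x)" for x
  proof -
    have "S x = (\<Sum>n. opow T n x)"
      using summable_apply[OF s, folded S_def] by simp
    also have "\<dots> = opow T 0 x + (\<Sum>n. opow T (Suc n) x)"
      using suminf_split_head[OF summable_apply(1)[OF s, of x]] by simp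
    also have "(\<Sum>n. opow T (Suc n) x) = T (S x)"
      using bounded_linear.suminf[OF blinfun.bounded_linear_right[of T] summable_apply(1)[OF s, of x]]
        summable_apply(2)[OF s, folded S_def, of x] by simp
    finally show ?thesis by simp
  qed
  have comm: "S (T x) = T (S x)" for x
    using bounded_linear.suminf[OF blinfun.bounded_linear_right[of T] summable_apply(1)[OF s, of x]]
      summable_apply(2)[OF s, folded S_def, of x] summable_apply(2)[OF s, folded S_def, of "T x"] by (simp add: opow_commute)
  show ?thesis unfolding S_def[symmetric]
  proof (rule is_op_inverseI)
    show "id_blinfun - T \<in> bounded_ops" using T by auto
    show "S ((id_blinfun - T) x) = x" for x
      unfolding blinfun.diff_left using split[of x] by (simp add: blinfun.diff_right comm algebra_simps)
    show "(id_blinfun - T) (S x) = x" for x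
      unfolding blinfun.diff_left using split[of x] by (simp add: algebra_simps)
  qed
qed

lemma norm_opow_le: "norm (opow T n) \<le> norm T ^ n" 
proof (induction n)
  case 0 show ?case using norm_blinfun_id_le by simp
next
  case (Suc n)
  then show ?case
    using norm_blinfun_compose[of T "opow T n"] mult_left_mono[OF Suc norm_ge_zero[of T]] by simp
qed

lemma neumann_small:
  fixes T :: "'a::{complex_normed_vector, banach} \<Rightarrow>\<^sub>L 'a"
  assumes T: "T \<in> bounded_ops" and lt: "norm T < 1"
  shows "op_invertible (id_blinfun - T)" and "norm (op_inv (id_blinfun - T)) \<le> 1 / (1 - norm T)"
proof -
  have g: "summable (\<lambda>n. norm T ^ n)" using lt by (simp add: summable_geometric)
  have s: "summable (\<lambda>n. norm (opow T n))"
    by (rule summable_comparison_test[OF _ g]) (simp add: norm_opow_le)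
  note inv = neumann_series[OF T s]
  show "op_invertible (id_blinfun - T)" using inv by (rule op_invertibleI)
  have "norm (\<Sum>n. opow T n) \<le> (\<Sum>n. norm (opow T n))" by (rule summable_norm[OF s])
  also have "\<dots> \<le> (\<Sum>n. norm T ^ n)" by (rule suminf_le[OF norm_opow_le s g])
  also have "\<dots> = 1 / (1 - norm T)" using lt by (simp add: suminf_geometric)
  finally show "norm (op_inv (id_blinfun - T)) \<le> 1 / (1 - norm T)"
    using op_inv_eqI[OF inv] by simp
qed

section \<open>Complex differentiability of the inverses of an affine operator family\<close>

lemma bounded_bilinear_scaleC:
  "bounded_bilinear (scaleC :: complex \<Rightarrow> 'a \<Rightarrow> 'a::complex_normed_vector)"
proof
  show "\<exists>K. \<forall>a (b::'a). norm (a *\<^sub>C b) \<le> norm a * norm b * K"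
    by (rule exI[of _ 1]) (simp add: norm_scaleC)
  show "(r *\<^sub>R a) *\<^sub>C b = r *\<^sub>R (a *\<^sub>C (b::'a))" for r a b
    by (metis scaleC_of_real scaleC_scaleC scaleR_conv_of_real)
qed (simp_all add: scaleC_add_left scaleC_add_right scaleC_scaleR)

text \<open>Near \<open>z\<close> the operator is the one at \<open>z\<close> times
  \<open>I - T\<close> with small \<open>T\<close>, so the inverses stay bounded by
  \<open>2 * norm S\<close>. The resolvent identity, inserted into itself, leaves a remainder
  quadratic in \<open>w - z\<close>. The affine form covers both \<open>I - zA\<close> and
  \<open>zI - A\<close>.\<close>

lemma affine_inverse:
  fixes X Y :: "'a::{complex_normed_vector, banach} \<Rightarrow>\<^sub>L 'a"
  assumes X: "X \<in> bounded_ops" and Y: "Y \<in> bounded_ops"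
    and inv: "op_invertible (X + z *\<^sub>C Y)"
  defines "S \<equiv> op_inv (X + z *\<^sub>C Y)"
  shows "eventually (\<lambda>w. op_invertible (X + w *\<^sub>C Y)) (nhds z)"
    and "((\<lambda>w. op_inv (X + w *\<^sub>C Y)) has_derivative (\<lambda>h. h *\<^sub>C (- (S o\<^sub>L Y o\<^sub>L S)))) (at z)"
proof -
  define M where "M w = X + w *\<^sub>C Y" for w
  have Sb: "S \<in> bounded_ops" unfolding S_def by (rule op_inv_bounded_ops[OF inv])
  have Mb: "M w \<in> bounded_ops" for w using X Y by (auto simp: M_def)
  have MS: "M z (S y) = y" for y
    unfolding S_def M_def by (rule op_inv_apply(2)[OF inv])
  \<comment> \<open>With this radius the operator \<open>T\<close> below has norm at most 1/2; the
    summand 1 keeps the denominator positive.\<close>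
  define \<delta> where "\<delta> = 1 / (2 * (norm (S o\<^sub>L Y) + 1))"
  have \<delta>: "\<delta> > 0" unfolding \<delta>_def by (simp add: add_nonneg_pos)
  have key: "op_invertible (M (z + h)) \<and> norm (op_inv (M (z + h))) \<le> 2 * norm S"
    if h: "norm h < \<delta>" for h
  proof -
    define T where "T = - (h *\<^sub>C (S o\<^sub>L Y))"
    have Tb: "T \<in> bounded_ops" using Sb Y by (auto simp: T_def)
    have "norm h * norm (S o\<^sub>L Y) \<le> \<delta> * (norm (S o\<^sub>L Y) + 1)"
      using h \<delta> by (intro mult_mono) auto
    also have "\<dots> = 1/2"
      unfolding \<delta>_def using norm_ge_zero[of "S o\<^sub>L Y"] by (simp add: divide_simps add_nonneg_eq_0_iff)
    finally have T: "norm T \<le> 1/2" by (simp add: T_def norm_scaleC)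
    then have "norm T < 1" by simp
    note N = neumann_small[OF Tb this]
    have eq: "M (z + h) = M z o\<^sub>L (id_blinfun - T)"
    proof (rule blinfun_eqI)
      fix x
      have "(M z o\<^sub>L (id_blinfun - T)) x = M z x + h *\<^sub>C Y x"
        by (simp add: T_def blinfun.add_left blinfun.diff_left blinfun.minus_left blinfun.add_right bounded_opsD[OF Mb] MS)
      then show "M (z + h) x = (M z o\<^sub>L (id_blinfun - T)) x"
        by (simp add: M_def blinfun.add_left scaleC_add_left)
    qed
    have i: "is_op_inverse (M (z + h)) (op_inv (id_blinfun - T) o\<^sub>L S)"
      unfolding eq S_def M_def[symmetric]
      by (rule is_op_inverse_compose[OF is_op_inverse_op_inv[OF inv[folded M_def]] is_op_inverse_op_inv[OF N(1)]])
    have "norm (op_inv (id_blinfun - T)) \<le> 2"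
      by (rule order_trans[OF N(2)]) (use T in \<open>simp add: divide_simps\<close>)
    then have "norm (op_inv (id_blinfun - T) o\<^sub>L S) \<le> 2 * norm S"
      by (meson norm_blinfun_compose mult_right_mono norm_ge_zero order_trans)
    then show ?thesis using op_inv_eqI[OF i] op_invertibleI[OF i] by simp
  qed
  have ev: "eventually (\<lambda>w. norm (w - z) < \<delta>) (nhds z)"
    unfolding eventually_nhds_metric using \<delta> by (auto simp: dist_norm)
  show "eventually (\<lambda>w. op_invertible (X + w *\<^sub>C Y)) (nhds z)"
    using ev
  proof eventually_elim
    case (elim w)
    then show ?case using key[of "w - z"] by (simp add: M_def)
  qed
  have err: "norm (op_inv (M w) - op_inv (M z) - (w - z) *\<^sub>C (- (S o\<^sub>L Y o\<^sub>L S)))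
      \<le> (2 * norm S * norm (Y o\<^sub>L S o\<^sub>L Y o\<^sub>L S)) * norm (w - z) * norm (w - z)"
    if w: "norm (w - z) < \<delta>" for w
  proof -
    define S' where "S' = op_inv (M w)"
    have iw: "op_invertible (M w)" and n: "norm S' \<le> 2 * norm S"
      using key[OF w] by (auto simp: S'_def)
    have S'b: "S' \<in> bounded_ops" unfolding S'_def by (rule op_inv_bounded_ops[OF iw])
    have Mw: "M w x = M z x + (w - z) *\<^sub>C Y x" for x
      by (simp add: M_def blinfun.bilinear_simps complex_vector.scale_left_diff_distrib)
    have d: "S' y = S y - (w - z) *\<^sub>C S' (Y (S y))" for y
    proof -
      have "M w (S y) = y + (w - z) *\<^sub>C Y (S y)"
        by (simp add: Mw MS)
      then have "S y = S' (y + (w - z) *\<^sub>C Y (S y))"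
        unfolding S'_def using op_inv_apply(1)[OF iw] by metis
      then have "S y = S' y + (w - z) *\<^sub>C S' (Y (S y))"
        by (simp only: blinfun.add_right bounded_opsD[OF S'b])
      then show ?thesis unfolding eq_diff_eq by (rule sym)
    qed
    have "S' - S - (w - z) *\<^sub>C (- (S o\<^sub>L Y o\<^sub>L S)) = ((w - z) * (w - z)) *\<^sub>C (S' o\<^sub>L (Y o\<^sub>L S o\<^sub>L Y o\<^sub>L S))"
    proof (rule blinfun_eqI)
      fix y
      \<comment> \<open>The identity \<open>d\<close> is applied a second time to its own right-hand
        side, which exposes the second-order term.\<close>
      have "S' y = S y - (w - z) *\<^sub>C (S (Y (S y)) - (w - z) *\<^sub>C S' (Y (S (Y (S y)))))"
        unfolding d[of "Y (S y)", symmetric] by (rule d)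
      then show "blinfun_apply (S' - S - (w - z) *\<^sub>C (- (S o\<^sub>L Y o\<^sub>L S))) y
        = blinfun_apply (((w - z) * (w - z)) *\<^sub>C (S' o\<^sub>L (Y o\<^sub>L S o\<^sub>L Y o\<^sub>L S))) y"
        by (simp add: blinfun.bilinear_simps scaleC_scaleC complex_vector.scale_right_diff_distrib)
    qed
    then have "norm (S' - S - (w - z) *\<^sub>C (- (S o\<^sub>L Y o\<^sub>L S)))
      = norm (w - z) * norm (w - z) * norm (S' o\<^sub>L (Y o\<^sub>L S o\<^sub>L Y o\<^sub>L S))"
      by (simp add: norm_scaleC norm_mult)
    moreover have "norm (S' o\<^sub>L (Y o\<^sub>L S o\<^sub>L Y o\<^sub>L S)) \<le> 2 * norm S * norm (Y o\<^sub>L S o\<^sub>L Y o\<^sub>L S)"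
      by (meson n norm_blinfun_compose mult_right_mono norm_ge_zero order_trans)
    note mult_left_mono[OF this, of "norm (w - z) * norm (w - z)"]
    moreover have "op_inv (M z) = S" by (simp add: S_def M_def)
    ultimately show ?thesis by (simp add: S'_def[symmetric] ac_simps)
  qed
  define K where "K = 2 * norm S * norm (Y o\<^sub>L S o\<^sub>L Y o\<^sub>L S)"
  have K: "K \<ge> 0" by (simp add: K_def)
  show "((\<lambda>w. op_inv (X + w *\<^sub>C Y)) has_derivative (\<lambda>h. h *\<^sub>C (- (S o\<^sub>L Y o\<^sub>L S)))) (at z)"
    unfolding has_derivative_within_alt
  proof (intro conjI allI impI)
    show "bounded_linear (\<lambda>h. h *\<^sub>C (- (S o\<^sub>L Y o\<^sub>L S)))"
      by (rule bounded_bilinear.bounded_linear_left[OF bounded_bilinear_scaleC])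
    fix e :: real assume e: "e > 0"
    define d where "d = min \<delta> (e / (K + 1))"
    have "d > 0" using \<delta> e K by (simp add: d_def)
    moreover have "norm (op_inv (X + w *\<^sub>C Y) - op_inv (X + z *\<^sub>C Y) - (w - z) *\<^sub>C (- (S o\<^sub>L Y o\<^sub>L S)))
       \<le> e * norm (w - z)" if "norm (w - z) < d" for w
    proof -
      have "K * norm (w - z) \<le> (K + 1) * (e / (K + 1))"
        using that K e by (intro mult_mono) (auto simp: d_def)
      also have "\<dots> = e" using K by simp
      finally have "K * norm (w - z) * norm (w - z) \<le> e * norm (w - z)"
        by (rule mult_right_mono) simp
      moreover have "norm (w - z) < \<delta>" using that by (simp add: d_def)
      ultimately show ?thesis using err[of w] unfolding M_def K_def by linarith
    qed
    ultimately show "\<exists>d>0. \<forall>y\<in>UNIV. norm (y - z) < d \<longrightarrow>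
      norm (op_inv (X + y *\<^sub>C Y) - op_inv (X + z *\<^sub>C Y) - (y - z) *\<^sub>C (- (S o\<^sub>L Y o\<^sub>L S))) \<le> e * norm (y - z)"
      by blast
  qed
qed


section \<open>The Riesz projection of a dichotomous operator\<close>

text \<open>Integration by parts: periodicity removes the boundary term, and each coefficient of
  \<open>f'\<close> is bounded by its supremum.\<close>

lemma fourier_integral_bound:
  fixes f :: "real \<Rightarrow> 'b::{complex_normed_vector, banach}"
  assumes der: "\<And>t. t \<in> {0..2*pi} \<Longrightarrow> (f has_vector_derivative f' t) (at t within {0..2*pi})"
    and cont: "continuous_on {0..2*pi} f'"
    and per: "f (2*pi) = f 0"
    and bound: "\<And>t. t \<in> {0..2*pi} \<Longrightarrow> norm (f' t) \<le> K"
  shows "\<bar>real_of_int n\<bar> * norm (integral {0..2*pi} (\<lambda>t. cis (n * t) *\<^sub>C f t)) \<le> 2 * pi * K"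
proof -
  note cb = bounded_bilinear.continuous_on[OF bounded_bilinear_scaleC]
  have contf: "continuous_on {0..2*pi} f"
    using der by (meson continuous_on_eq_continuous_within has_vector_derivative_continuous)
  have cis': "((\<lambda>t. cis (n * t)) has_vector_derivative (\<i> * n) * cis (n * t)) (at t within X)" for t :: real and X
  proof -
    have "((\<lambda>z. exp (\<i> * (of_int n * z))) has_field_derivative (\<i> * n) * exp (\<i> * (of_int n * of_real t)))
        (at (complex_of_real t))"
      by (auto intro!: derivative_eq_intros)
    from has_vector_derivative_real_field[OF this, of X] show ?thesis
      by (simp add: cis_conv_exp)
  qed
  have cc: "continuous_on X (\<lambda>t. cis (n * t))" for X :: "real set"
    by (intro continuous_intros)
  have D: "((\<lambda>t. cis (n * t) *\<^sub>C f t) has_vector_derivative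
      (cis (n * t) *\<^sub>C f' t + ((\<i> * n) * cis (n * t)) *\<^sub>C f t)) (at t within {0..2*pi})"
    if "t \<in> {0..2*pi}" for t :: real
    by (rule bounded_bilinear.has_vector_derivative[OF bounded_bilinear_scaleC cis' der[OF that]])
  have "((\<lambda>t. cis (n * t) *\<^sub>C f' t + ((\<i> * n) * cis (n * t)) *\<^sub>C f t) has_integral
      (cis (n * (2*pi)) *\<^sub>C f (2*pi) - cis (n * (0::real)) *\<^sub>C f 0)) {0..2*pi}"
    by (rule fundamental_theorem_of_calculus) (use D in auto)
  moreover have "cis (n * (2 * pi)) = 1"
    using cis_multiple_2pi[of "real_of_int n"] by (simp add: mult.commute mult.left_commute)
  ultimately have I: "((\<lambda>t. cis (n * t) *\<^sub>C f' t + ((\<i> * n) * cis (n * t)) *\<^sub>C f t) has_integral 0) {0..2*pi}"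
    using per by simp
  have i1: "(\<lambda>t. cis (n * t) *\<^sub>C f' t) integrable_on {0..2*pi}"
    by (intro integrable_continuous_real cb cc cont)
  have i2: "(\<lambda>t. cis (n * t) *\<^sub>C f t) integrable_on {0..2*pi}"
    by (intro integrable_continuous_real cb cc contf)
  have i2': "(\<lambda>t. ((\<i> * n) * cis (n * t)) *\<^sub>C f t) integrable_on {0..2*pi}"
    and e2: "integral {0..2*pi} (\<lambda>t. ((\<i> * n) * cis (n * t)) *\<^sub>C f t)
      = (\<i> * n) *\<^sub>C integral {0..2*pi} (\<lambda>t. cis (n * t) *\<^sub>C f t)"
    using integrable_linear[OF i2 bounded_linear_scaleC_right[of "\<i> * n"]]
      integral_linear[OF i2 bounded_linear_scaleC_right[of "\<i> * n"]]
    by (simp_all add: o_def scaleC_scaleC)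
  have "integral {0..2*pi} (\<lambda>t. cis (n * t) *\<^sub>C f' t)
      + (\<i> * n) *\<^sub>C integral {0..2*pi} (\<lambda>t. cis (n * t) *\<^sub>C f t) = 0"
    using integral_unique[OF I] by (simp add: integral_add[OF i1 i2'] e2)
  then have "(\<i> * n) *\<^sub>C integral {0..2*pi} (\<lambda>t. cis (n * t) *\<^sub>C f t)
      = - integral {0..2*pi} (\<lambda>t. cis (n * t) *\<^sub>C f' t)"
    by (rule minus_unique[symmetric])
  then have "norm ((\<i> * n) *\<^sub>C integral {0..2*pi} (\<lambda>t. cis (n * t) *\<^sub>C f t))
      = norm (integral {0..2*pi} (\<lambda>t. cis (n * t) *\<^sub>C f' t))"
    by (simp only: norm_minus_cancel)
  also have "\<dots> \<le> K * (2 * pi - 0)"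
    by (rule integral_bound) (auto intro!: cb cc cont simp: norm_scaleC bound)
  finally show ?thesis
    by (simp add: norm_scaleC norm_mult mult.commute)
qed

text \<open>For nonzero \<open>n\<close> the decay estimate with vanishing derivative already forces
  the value 0.\<close>

lemma integral_cis_const:
  fixes x :: "'b::{complex_normed_vector, banach}"
  shows "integral {0..2*pi} (\<lambda>t. cis (real_of_int n * t) *\<^sub>C x) = (if n = 0 then (2 * pi) *\<^sub>R x else 0)"
proof (cases "n = 0")
  case True
  then show ?thesis by simp
next
  case False
  have "\<bar>real_of_int n\<bar> * norm (integral {0..2*pi} (\<lambda>t. cis (n * t) *\<^sub>C x)) \<le> 2 * pi * 0"
    by (rule fourier_integral_bound[where f' = "\<lambda>_. 0"]) auto
  then show ?thesis using False by (simp add: mult_le_0_iff)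
qed

text \<open>Here \<open>Q\<close> is the inverse of \<open>A\<close> on \<open>ker P\<close>, extended by 0 on the range of \<open>P\<close>.\<close>

locale dichotomy_splitting =
  fixes A P Q :: "'a::{complex_normed_vector, banach} \<Rightarrow>\<^sub>L 'a"
  assumes A_ops: "A \<in> bounded_ops" and P_ops: "P \<in> bounded_ops" and Q_ops: "Q \<in> bounded_ops"
    and P_A: "\<And>x. blinfun_apply P (blinfun_apply A x) = blinfun_apply A (blinfun_apply P x)"
    and A_Q: "\<And>x. blinfun_apply A (blinfun_apply Q x) = x - blinfun_apply P x"
    and Q_A: "\<And>x. blinfun_apply Q (blinfun_apply A x) = x - blinfun_apply P x"
    and P_Q: "\<And>x. blinfun_apply P (blinfun_apply Q x) = 0"
    and Q_P: "\<And>x. blinfun_apply Q (blinfun_apply P x) = 0"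
    and P_P: "\<And>x. blinfun_apply P (blinfun_apply P x) = blinfun_apply P x"
    and AP_summable: "summable (\<lambda>n. norm (opow (A o\<^sub>L P) n))"
    and Q_summable: "summable (\<lambda>n. norm (opow Q n))"

lemma resolvent_derivative:
  fixes A :: "'a::{complex_normed_vector, banach} \<Rightarrow>\<^sub>L 'a"
  assumes "A \<in> bounded_ops" "op_invertible (z *\<^sub>C id_blinfun - A)"
  shows "((\<lambda>w. op_inv (w *\<^sub>C id_blinfun - A)) has_derivative
    (\<lambda>h. h *\<^sub>C (- (op_inv (z *\<^sub>C id_blinfun - A) o\<^sub>L op_inv (z *\<^sub>C id_blinfun - A))))) (at z)"
proof -
  have eq: "- A + w *\<^sub>C id_blinfun = w *\<^sub>C id_blinfun - A" for w by simp
  have "S o\<^sub>L id_blinfun o\<^sub>L S = S o\<^sub>L S" for S :: "'a \<Rightarrow>\<^sub>L 'a"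
    by (rule blinfun_eqI) simp
  then show ?thesis
    using affine_inverse(2)[of "- A" id_blinfun z] assms by (simp add: eq)
qed

text \<open>
  Put \<open>S\<^sub>n = (1 / 2\<pi>\<i>) \<integral> z\<^sup>n\<^sup>-\<^sup>1 (zI - A)\<^sup>-\<^sup>1 dz\<close>, so that \<open>P = S\<^sub>1\<close> and \<open>Q = - S\<^sub>0\<close>. The identity
  \<open>A S\<^sub>n = S\<^sub>n\<^sub>+\<^sub>1 - \<delta>\<^sub>n\<^sub>0 I\<close> gives \<open>P S\<^sub>-\<^sub>k = S\<^sub>m\<^sub>+\<^sub>1 S\<^sub>-\<^sub>k\<^sub>-\<^sub>m\<close> for all \<open>m\<close>, which vanishes as \<open>S\<^sub>n\<close> decays
  like \<open>1 / n\<close>; this replaces the usual argument with two contours.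
\<close>

lemma riesz_projection_splitting:
  fixes A :: "'a::complex_hilbert_space \<Rightarrow>\<^sub>L 'a"
  assumes A: "A \<in> bounded_ops" and dich: "dichotomous A"
  obtains Q where "dichotomy_splitting A (riesz_projection A) Q"
proof -
  define R where "R z = op_inv (z *\<^sub>C id_blinfun - A)" for z
  define S where "S n = (1 / (2 * pi)) *\<^sub>R integral {0..2*pi} (\<lambda>t. cis (real_of_int n * t) *\<^sub>C R (cis t))" for n
  \<comment> \<open>Up to a unimodular factor the squared resolvent is the derivative of the
    resolvent along the circle, so \<open>c\<close> is the constant in the decay estimate.\<close>
  define c where "c = Sup ((\<lambda>t. norm (R (cis t) o\<^sub>L R (cis t))) ` {0..2*pi})"
  have inv: "op_invertible (cis t *\<^sub>C id_blinfun - A)" for t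
  proof -
    have "cis t \<in> sphere 0 1" by simp
    then show ?thesis using dich by (auto simp: dichotomous_def op_spectrum_def)
  qed
  have RA: "R (cis t) (A x) = A (R (cis t) x)" and AR: "A (R (cis t) x) = cis t *\<^sub>C R (cis t) x - x"
    and Rb: "R (cis t) \<in> bounded_ops" for t x
  proof -
    show Rb: "R (cis t) \<in> bounded_ops" unfolding R_def by (rule op_inv_bounded_ops[OF inv])
    show AR: "A (R (cis t) x) = cis t *\<^sub>C R (cis t) x - x"
      using op_inv_apply(2)[OF inv[of t], of x] by (simp add: R_def[symmetric] blinfun.bilinear_simps algebra_simps)
    have "R (cis t) (A x) = cis t *\<^sub>C R (cis t) x - x"
      using op_inv_apply(1)[OF inv[of t], of x]
      by (simp add: R_def[symmetric] blinfun.bilinear_simps bounded_opsD[OF Rb] algebra_simps)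
    then show "R (cis t) (A x) = A (R (cis t) x)" using AR by simp
  qed
  have R': "((\<lambda>t. R (cis t)) has_vector_derivative ((\<i> * cis t) *\<^sub>C (- (R (cis t) o\<^sub>L R (cis t)))))
      (at t within X)" for t X
  proof -
    have c: "(cis has_derivative (\<lambda>s. s *\<^sub>R (\<i> * cis t))) (at t within X)"
      unfolding has_vector_derivative_def[symmetric] cis_conv_exp
      by (rule has_vector_derivative_real_field) (auto intro!: derivative_eq_intros)
    have "(R has_derivative (\<lambda>h. h *\<^sub>C (- (R (cis t) o\<^sub>L R (cis t))))) (at (cis t))"
      unfolding R_def by (rule resolvent_derivative[OF A inv])
    from has_derivative_compose[OF c this]
    show ?thesis
      unfolding has_vector_derivative_def
      by (simp flip: scaleC_of_real add: scaleC_complex_def scaleC_scaleC)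
  qed
  note cb = bounded_bilinear.continuous_on[OF bounded_bilinear_scaleC]
  have contR: "continuous_on X (\<lambda>t. R (cis t))" for X
    using R' by (meson continuous_on_eq_continuous_within has_vector_derivative_continuous)
  have contRR: "continuous_on X (\<lambda>t. R (cis t) o\<^sub>L R (cis t))" for X
    by (intro bounded_bilinear.continuous_on[OF bounded_bilinear_blinfun_compose] contR)
  have c_bound: "norm (R (cis t) o\<^sub>L R (cis t)) \<le> c" if "t \<in> {0..2*pi}" for t
    unfolding c_def using that
    by (intro cSUP_upper bounded_imp_bdd_above compact_imp_bounded compact_continuous_image
        continuous_on_norm contRR) auto
  have c0: "c \<ge> 0" using order_trans[OF norm_ge_zero c_bound[of 0]] by simp
  have Sdecay: "\<bar>real_of_int n\<bar> * norm (S n) \<le> c" for n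
  proof -
    have "\<bar>real_of_int n\<bar> * norm (integral {0..2*pi} (\<lambda>t. cis (n * t) *\<^sub>C R (cis t))) \<le> 2 * pi * c"
    proof (rule fourier_integral_bound[OF R'])
      show "continuous_on {0..2*pi} (\<lambda>t. (\<i> * cis t) *\<^sub>C (- (R (cis t) o\<^sub>L R (cis t))))"
        by (intro cb continuous_on_minus contRR continuous_intros)
    qed (auto simp: norm_scaleC norm_mult c_bound)
    then show ?thesis by (simp add: S_def field_simps)
  qed
  have int: "(\<lambda>t. cis (real_of_int n * t) *\<^sub>C R (cis t)) integrable_on {0..2*pi}" for n
    by (intro integrable_continuous_real cb contR continuous_intros)
  \<comment> \<open>Bounded linear maps pass under the integral; this is used for evaluation at a
    vector, alone and followed by \<open>A\<close>.\<close>
  have lin: "L (S n) = (1 / (2 * pi)) *\<^sub>R integral {0..2*pi} (\<lambda>t. L (cis (real_of_int n * t) *\<^sub>C R (cis t)))"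
    if "bounded_linear L" for L :: "('a \<Rightarrow>\<^sub>L 'a) \<Rightarrow> 'c::banach" and n
    using integral_linear[OF int that, of n] linear_cmul[OF bounded_linear.linear[OF that]]
    by (simp add: S_def o_def)
  have Sx: "S n x = (1 / (2 * pi)) *\<^sub>R integral {0..2*pi} (\<lambda>t. cis (real_of_int n * t) *\<^sub>C R (cis t) x)" for n x
    using lin[OF blinfun.bounded_linear_left[of x], of n] by simp
  have ASx: "A (S n x) = (1 / (2 * pi)) *\<^sub>R integral {0..2*pi} (\<lambda>t. cis (real_of_int n * t) *\<^sub>C A (R (cis t) x))" for n x
    using lin[OF bounded_linear_compose[OF blinfun.bounded_linear_right[of A] blinfun.bounded_linear_left[of x]], of n]
    by (simp add: bounded_opsD[OF A])
  have S_ops: "S n \<in> bounded_ops" for n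
  proof -
    have i: "(\<lambda>t. cis (real_of_int n * t) *\<^sub>C R (cis t) x) integrable_on {0..2*pi}" for x
      using integrable_linear[OF int blinfun.bounded_linear_left[of x], of n] by (simp add: o_def)
    have "S n (d *\<^sub>C x) = d *\<^sub>C S n x" for d x
    proof -
      have "integral {0..2*pi} (\<lambda>t. cis (real_of_int n * t) *\<^sub>C R (cis t) (d *\<^sub>C x))
        = integral {0..2*pi} ((*\<^sub>C) d \<circ> (\<lambda>t. cis (real_of_int n * t) *\<^sub>C R (cis t) x))"
        by (simp add: o_def bounded_opsD[OF Rb] scaleC_scaleC mult.commute)
      then show ?thesis
        unfolding Sx by (simp add: integral_linear[OF i bounded_linear_scaleC_right] scaleC_scaleR)
    qed
    then show ?thesis by (simp add: bounded_ops_def)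
  qed
  have SA: "S n (A x) = A (S n x)" for n x
    unfolding ASx by (simp add: Sx RA)
  \<comment> \<open>From \<open>A R(z) = z R(z) - I\<close>: the contribution of \<open>I\<close>
    integrates to zero in every mode except \<open>n = 0\<close>.\<close>
  have AS: "A (S n x) = S (n + 1) x - (if n = 0 then x else 0)" for n x
  proof -
    have i: "(\<lambda>t. cis (real_of_int (n + 1) * t) *\<^sub>C R (cis t) x) integrable_on {0..2*pi}" for n
      using integrable_linear[OF int blinfun.bounded_linear_left[of x], of "n + 1"] by (simp add: o_def)
    have "A (S n x) = (1 / (2 * pi)) *\<^sub>R integral {0..2*pi}
        (\<lambda>t. cis (real_of_int (n + 1) * t) *\<^sub>C R (cis t) x - cis (real_of_int n * t) *\<^sub>C x)"
      unfolding ASx AR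
      by (simp add: complex_vector.scale_right_diff_distrib scaleC_scaleC cis_mult algebra_simps)
    also have "\<dots> = S (n + 1) x - (1 / (2 * pi)) *\<^sub>R integral {0..2*pi} (\<lambda>t. cis (real_of_int n * t) *\<^sub>C x)"
      unfolding Sx scaleR_right_diff_distrib[symmetric]
      by (subst integral_diff[OF i]) (auto intro!: integrable_continuous_real cb continuous_intros)
    finally show ?thesis by (simp add: integral_cis_const)
  qed
  define P where "P = S 1"
  define Q where "Q = - S 0"
  have P: "riesz_projection A = P"
  proof -
    have "circle_integral R = \<i> *\<^sub>C integral {0..2*pi} (\<lambda>t. cis (real_of_int 1 * t) *\<^sub>C R (cis t))"
      unfolding circle_integral_def
      using integral_linear[OF int[of 1] bounded_linear_scaleC_right[of \<i>]] by (simp add: o_def scaleC_scaleC)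
    then have "riesz_projection A = (1 / (2 * of_real pi * \<i>)) *\<^sub>C \<i> *\<^sub>C
        integral {0..2*pi} (\<lambda>t. cis (real_of_int 1 * t) *\<^sub>C R (cis t))"
      unfolding riesz_projection_def R_def by simp
    then show ?thesis
      unfolding P_def S_def by (simp flip: scaleC_of_real add: scaleC_scaleC field_simps)
  qed
  \<comment> \<open>Climbing upwards from index 1 never meets the exceptional index 0.\<close>
  have SP: "S (int n + 1) = opow A n o\<^sub>L P" for n
  proof (induction n)
    case 0
    show ?case by (auto intro!: blinfun_eqI simp: P_def)
  next
    case (Suc n)
    have "S (int (Suc n) + 1) x = A (S (int n + 1) x)" for x
      using AS[of "int n + 1" x] by (simp add: algebra_simps)
    then show ?case by (auto intro!: blinfun_eqI simp: Suc)
  qed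
  \<comment> \<open>Here \<open>A\<close> is applied only at the indices from
    \<open>- (k + m)\<close> to \<open>- (k + 1)\<close>, which are all negative.\<close>
  have SN: "S (- int k) x = opow A m (S (- int (k + m)) x)" for k m x
  proof (induction m)
    case (Suc m)
    have "A (S (- int (k + Suc m)) x) = S (- int (k + m)) x"
      using AS[of "- int (k + Suc m)" x] by (simp add: algebra_simps)
    then show ?case by (simp add: Suc opow_commute[symmetric])
  qed auto
  have opow_A: "opow A m (S n x) = S n (opow A m x)" for m n x
    by (induction m) (auto simp: SA)
  have over_lim: "(\<lambda>n. c / (real (n + k) + 1)) \<longlonglongrightarrow> 0" for k :: nat
    using LIMSEQ_ignore_initial_segment[OF lim_const_over_n[of c], of "k + 1"] by (simp add: ac_simps)
  have prod_zero: "(S (- int k) (P x)) = 0" "(P (S (- int k) x)) = 0" for k x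
  proof -
    \<comment> \<open>Shifting by \<open>m + 1\<close> rather than \<open>m\<close> keeps both
      Fourier indices nonzero, so that each factor decays even when \<open>k\<close> and
      \<open>m\<close> are 0.\<close>
    define b where "b m = c / (real (m + 1) + 1) * (c / (real (m + k) + 1))" for m
    have le: "norm (S (int (m + 1) + 1)) * norm (S (- int (k + (m + 1)))) \<le> b m" for m
      unfolding b_def
      using Sdecay[of "int (m + 1) + 1"] Sdecay[of "- int (k + (m + 1))"] c0
      by (intro mult_mono) (auto simp: field_simps)
    have PS: "P (S (- int k) x) = (S (int (m + 1) + 1) o\<^sub>L S (- int (k + (m + 1)))) x" for m
      using SN[of k x "m + 1"] opow_A[of "m + 1" 1] by (simp only: SP) (simp add: P_def)
    have SPx: "S (- int k) (P x) = (S (- int (k + (m + 1))) o\<^sub>L S (int (m + 1) + 1)) x" for m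
      using SN[of k "P x" "m + 1"] opow_A[of "m + 1" "- int (k + (m + 1))"] by (simp only: SP) simp
    have "norm (P (S (- int k) x)) \<le> b m * norm x" for m
      unfolding PS[of m] using order_trans[OF norm_blinfun_compose le[of m]]
      by (meson mult_right_mono norm_blinfun norm_ge_zero order_trans)
    moreover have "norm (S (- int k) (P x)) \<le> b m * norm x" for m
      unfolding SPx[of m] using order_trans[OF norm_blinfun_compose le[unfolded mult.commute[of "norm (S (int (m + 1) + 1))" for m]]]
      by (meson mult_right_mono norm_blinfun norm_ge_zero order_trans)
    moreover have "b \<longlonglongrightarrow> 0 * 0"
      unfolding b_def using over_lim[of 1] over_lim[of k] by (intro tendsto_mult) (simp_all add: add.commute)
    then have "(\<lambda>m. b m * norm x) \<longlonglongrightarrow> 0 * norm x" by (intro tendsto_mult tendsto_const) simp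
    ultimately have "norm (P (S (- int k) x)) \<le> 0" "norm (S (- int k) (P x)) \<le> 0"
      by (auto intro!: LIMSEQ_le_const simp del: norm_le_zero_iff)
    then show "(S (- int k) (P x)) = 0" "(P (S (- int k) x)) = 0" by simp_all
  qed
  have AQ: "A (Q x) = x - P x" "Q (A x) = x - P x" for x
    using AS[of 0 x] SA[of 0 x] by (auto simp: Q_def P_def blinfun.minus_left blinfun.minus_right)
  have PQ: "P (Q x) = 0" "Q (P x) = 0" for x
    using prod_zero[of 0 x] by (auto simp: Q_def blinfun.minus_left blinfun.minus_right)
  have PP: "P (P x) = P x" for x
    using AQ(1)[of "P x"] PQ(2)[of x] by simp
  \<comment> \<open>Only positive powers are covered: the zeroth power is the identity, whereas
    \<open>S 1\<close> is \<open>P\<close>.\<close>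
  have opow_AP: "opow (A o\<^sub>L P) (Suc n) = S (int (Suc n) + 1)" for n
  proof (rule blinfun_eqI)
    fix x
    have "opow (A o\<^sub>L P) (Suc n) x = opow A (Suc n) (P x)"
    proof (induction n)
      case (Suc n)
      have "P (opow A (Suc n) (P x)) = opow A (Suc n) (P (P x))"
        unfolding P_def by (rule opow_A[symmetric])
      then show ?case using Suc PP by simp
    qed simp
    then show "opow (A o\<^sub>L P) (Suc n) x = S (int (Suc n) + 1) x"
      unfolding SP by simp
  qed
  \<comment> \<open>\<open>S (- int n)\<close> is \<open>A\<close> applied to
    \<open>S (- int (Suc n))\<close>, whose range lies in the kernel of \<open>P\<close>, where
    \<open>Q\<close> undoes \<open>A\<close>. So \<open>Q\<close> lowers the index by one.\<close>
  have opow_Q: "opow Q (Suc n) = - S (- int n)" for n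
  proof (induction n)
    case 0
    show ?case by (auto intro!: blinfun_eqI simp: Q_def)
  next
    case (Suc n)
    have "Q (S (- int n) x) = S (- int (Suc n)) x" for x
    proof -
      have "S (- int n) x = A (S (- int (Suc n)) x)"
        using SN[of n x 1] by simp
      then show ?thesis using prod_zero(2)[of "Suc n" x] by (simp add: AQ)
    qed
    then have "opow Q (Suc (Suc n)) x = - S (- int (Suc n)) x" for x
      by (subst opow.simps) (simp add: Suc blinfun.minus_left blinfun.minus_right del: opow.simps)
    then show ?case by (auto intro!: blinfun_eqI simp: blinfun.minus_left)
  qed
  \<comment> \<open>A bound of order 1/n is not summable in itself, but convergence of the powers to
    zero is what \<open>opow_summable\<close> requires. The offset 2 avoids \<open>S 0\<close>, on
    which the decay estimate says nothing.\<close>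
  have lim: "(\<lambda>n. norm (opow T n)) \<longlonglongrightarrow> 0" if "\<And>n. norm (opow T (Suc (Suc n))) \<le> c / (real n + 1)"
    for T :: "'a \<Rightarrow>\<^sub>L 'a"
  proof -
    have "(\<lambda>n. c / (real n + 1)) \<longlonglongrightarrow> 0" using over_lim[of 0] by simp
    then have "(\<lambda>n. norm (opow T (n + 2))) \<longlonglongrightarrow> 0"
      by (rule Lim_null_comparison[rotated])
        (use that in \<open>auto simp: numeral_2_eq_2 simp del: opow.simps\<close>)
    then show ?thesis by (rule LIMSEQ_offset)
  qed
  have "dichotomy_splitting A P Q"
  proof
    show "A \<in> bounded_ops" "P \<in> bounded_ops" "Q \<in> bounded_ops"
      using A S_ops by (auto simp: P_def Q_def)
    show "P (A x) = A (P x)" for x unfolding P_def by (rule SA)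
    have "norm (opow (A o\<^sub>L P) (Suc (Suc n))) \<le> c / (real n + 1)" for n
      unfolding opow_AP using Sdecay[of "int (Suc (Suc n)) + 1"] c0
      by (auto simp: field_simps intro: order_trans[rotated])
    then show "summable (\<lambda>n. norm (opow (A o\<^sub>L P) n))" by (intro opow_summable lim)
    have "norm (opow Q (Suc (Suc n))) \<le> c / (real n + 1)" for n
      unfolding opow_Q using Sdecay[of "- int (Suc n)"] by (simp add: field_simps)
    then show "summable (\<lambda>n. norm (opow Q n))" by (intro opow_summable lim)
  qed (use AQ PQ PP in auto)
  then show ?thesis using that P by simp
qed


section \<open>Toeplitz operators with contractive symbol\<close>

lemma cinner_sum_left: "cinner (\<Sum>i\<in>J. f i) y = (\<Sum>i\<in>J. cinner (f i) (y::'a::complex_inner))"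
proof -
  have "cinner 0 y = 0" using cinner_add_left[of 0 0 y] by simp
  then show ?thesis by (induction J rule: infinite_finite_induct) (auto simp: cinner_add_left)
qed

lemma cinner_sum_right: "cinner y (\<Sum>i\<in>J. f i) = (\<Sum>i\<in>J. cinner (y::'a::complex_inner) (f i))"
  using arg_cong[OF cinner_sum_left[of f J y], of cnj] by (simp add: cinner_commute[symmetric])

lemma cinner_scaleC_right: "cinner x (c *\<^sub>C y) = cnj c * cinner x (y::'a::complex_inner)"
  using arg_cong[OF cinner_scaleC_left[of c y x], of cnj] by (simp add: cinner_commute[symmetric])

text \<open>Expanding the squared norm by the inner product gives a double sum of exponentials, of
  which only the diagonal survives integration.\<close>

lemma parseval_trig_poly:
  fixes c :: "int \<Rightarrow> 'u::complex_inner"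
  assumes "finite J"
  shows "((\<lambda>t. (norm (\<Sum>m\<in>J. cis (real_of_int m * t) *\<^sub>C c m))\<^sup>2) has_integral
    (2 * pi * (\<Sum>m\<in>J. (norm (c m))\<^sup>2))) {0..2*pi}"
proof -
  have I: "((\<lambda>t. cis (real_of_int n * t) *\<^sub>C x) has_integral (if n = 0 then (2 * pi) *\<^sub>R x else 0)) {0..2*pi}"
    for n and x :: complex
    unfolding integral_cis_const[symmetric]
    by (intro integrable_integral integrable_continuous_real continuous_intros
        bounded_bilinear.continuous_on[OF bounded_bilinear_scaleC])
  have eq: "complex_of_real ((norm (\<Sum>m\<in>J. cis (real_of_int m * t) *\<^sub>C c m))\<^sup>2)
    = (\<Sum>m\<in>J. \<Sum>k\<in>J. cis (real_of_int (m - k) * t) *\<^sub>C cinner (c m) (c k))" for t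
    unfolding cinner_self[symmetric]
    by (simp only: cinner_sum_left cinner_sum_right, subst sum.swap)
      (simp add: cinner_scaleC_left cinner_scaleC_right scaleC_complex_def
        cis_cnj cis_mult sum_distrib_left left_diff_distrib mult.assoc[symmetric])
  have "((\<lambda>t. \<Sum>m\<in>J. \<Sum>k\<in>J. cis (real_of_int (m - k) * t) *\<^sub>C cinner (c m) (c k)) has_integral
     (\<Sum>m\<in>J. \<Sum>k\<in>J. if m - k = 0 then (2 * pi) *\<^sub>R cinner (c m) (c k) else 0)) {0..2*pi}"
    by (intro has_integral_sum assms I)
  also have "(\<Sum>m\<in>J. \<Sum>k\<in>J. if m - k = 0 then (2 * pi) *\<^sub>R cinner (c m) (c k) else 0)
    = (\<Sum>m\<in>J. \<Sum>k\<in>J. if m = k then (2 * pi) *\<^sub>R cinner (c m) (c k) else 0)"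
    by simp
  also have "\<dots> = complex_of_real (2 * pi * (\<Sum>m\<in>J. (norm (c m))\<^sup>2))"
    using assms by (simp add: sum.delta cinner_self scaleR_conv_of_real sum_distrib_left)
  finally have "((\<lambda>t. complex_of_real ((norm (\<Sum>m\<in>J. cis (real_of_int m * t) *\<^sub>C c m))\<^sup>2)) has_integral
     complex_of_real (2 * pi * (\<Sum>m\<in>J. (norm (c m))\<^sup>2))) {0..2*pi}"
    unfolding eq .
  from has_integral_linear[OF this bounded_linear_Re] show ?thesis
    by (simp only: o_def Re_complex_of_real)
qed

text \<open>Multiplication by the symbol is a pointwise estimate on the circle, which Parseval turns
  into an estimate of coefficients; restricting to the frequencies in \<open>S\<close> only
  decreases the left side.\<close>

lemma laurent_multiplication_bound:
  fixes a :: "int \<Rightarrow> 'u::complex_inner \<Rightarrow>\<^sub>L 'v::complex_inner"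
  assumes fin: "finite I" "finite J" "finite S"
    and a: "\<And>n. a n \<in> bounded_ops"
    and bound: "\<And>t. norm (\<Sum>n\<in>I. cis (real_of_int n * t) *\<^sub>C a n) \<le> \<rho>"
    and S: "\<And>k l. k \<in> S \<Longrightarrow> l \<in> J \<Longrightarrow> k - l \<in> I"
  shows "(\<Sum>k\<in>S. (norm (\<Sum>l\<in>J. a (k - l) (u l)))\<^sup>2) \<le> \<rho>\<^sup>2 * (\<Sum>l\<in>J. (norm (u l))\<^sup>2)"
proof -
  \<comment> \<open>\<open>K\<close> contains every frequency of the product; those of
    \<open>S\<close> that do not arise get the coefficient 0 as an empty sum.\<close>
  define K where "K = (\<lambda>(n, l). n + l) ` (I \<times> J) \<union> S"
  define c where "c k = (\<Sum>(n, l)\<in>{p \<in> I \<times> J. (case p of (n, l) \<Rightarrow> n + l) = k}. a n (u l))" for k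
  define h where "h t = (\<Sum>l\<in>J. cis (real_of_int l * t) *\<^sub>C u l)" for t
  define f where "f t = (\<Sum>k\<in>K. cis (real_of_int k * t) *\<^sub>C c k)" for t
  have finK: "finite K" using fin by (auto simp: K_def)
  have f: "f t = (\<Sum>n\<in>I. cis (real_of_int n * t) *\<^sub>C a n) (h t)" for t
  proof -
    have "f t = (\<Sum>k\<in>K. \<Sum>p\<in>{p \<in> I \<times> J. (case p of (n, l) \<Rightarrow> n + l) = k}.
        case p of (n, l) \<Rightarrow> cis (real_of_int (n + l) * t) *\<^sub>C a n (u l))"
      unfolding f_def c_def complex_vector.scale_sum_right
      by (intro sum.cong refl) (auto simp: case_prod_beta)
    also have "\<dots> = (\<Sum>(n, l)\<in>I \<times> J. cis (real_of_int (n + l) * t) *\<^sub>C a n (u l))"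
      using fin finK by (intro sum.group) (auto simp: K_def)
    also have "\<dots> = (\<Sum>n\<in>I. \<Sum>l\<in>J. cis (real_of_int (n + l) * t) *\<^sub>C a n (u l))"
      by (rule sum.cartesian_product[symmetric])
    also have "\<dots> = (\<Sum>n\<in>I. cis (real_of_int n * t) *\<^sub>C a n) (h t)"
      unfolding blinfun.sum_left
      by (simp add: h_def blinfun.sum_right bounded_opsD[OF a]
          complex_vector.scale_sum_right scaleC_scaleC cis_mult algebra_simps)
    finally show ?thesis .
  qed
  \<comment> \<open>For \<open>k\<close> in \<open>S\<close> each \<open>k - l\<close> lies in
    \<open>I\<close>, so truncating the symbol loses no term.\<close>
  have c: "c k = (\<Sum>l\<in>J. a (k - l) (u l))" if "k \<in> S" for k
    unfolding c_def
    by (rule sum.reindex_bij_witness[of _ "\<lambda>l. (k - l, l)" snd]) (use S[OF that] in auto)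
  have "2 * pi * (\<Sum>k\<in>K. (norm (c k))\<^sup>2) \<le> \<rho>\<^sup>2 * (2 * pi * (\<Sum>l\<in>J. (norm (u l))\<^sup>2))"
  proof (rule has_integral_le)
    show "((\<lambda>t. (norm (f t))\<^sup>2) has_integral 2 * pi * (\<Sum>k\<in>K. (norm (c k))\<^sup>2)) {0..2*pi}"
      unfolding f_def by (rule parseval_trig_poly[OF finK])
    show "((\<lambda>t. \<rho>\<^sup>2 * (norm (h t))\<^sup>2) has_integral \<rho>\<^sup>2 * (2 * pi * (\<Sum>l\<in>J. (norm (u l))\<^sup>2))) {0..2*pi}"
      unfolding h_def by (intro has_integral_mult_right parseval_trig_poly fin)
    show "(norm (f t))\<^sup>2 \<le> \<rho>\<^sup>2 * (norm (h t))\<^sup>2" for t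
      unfolding f power_mult_distrib[symmetric]
      by (intro power_mono order_trans[OF norm_blinfun] mult_right_mono bound) auto
  qed
  then have "2 * pi * (\<Sum>k\<in>K. (norm (c k))\<^sup>2) \<le> 2 * pi * (\<rho>\<^sup>2 * (\<Sum>l\<in>J. (norm (u l))\<^sup>2))"
    by (simp only: mult.left_commute mult.assoc)
  then have "(\<Sum>k\<in>K. (norm (c k))\<^sup>2) \<le> \<rho>\<^sup>2 * (\<Sum>l\<in>J. (norm (u l))\<^sup>2)"
    by (rule mult_left_le_imp_le) simp
  moreover have "(\<Sum>k\<in>S. (norm (c k))\<^sup>2) \<le> (\<Sum>k\<in>K. (norm (c k))\<^sup>2)"
    using finK by (intro sum_mono2) (auto simp: K_def)
  ultimately show ?thesis by (simp add: c)
qed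

text \<open>
  The contractivity of the symbol is only required of its truncated Fourier series, so that
  everything reduces to trigonometric polynomials.
\<close>

locale toeplitz_contraction =
  fixes a :: "int \<Rightarrow> 'u::complex_hilbert_space \<Rightarrow>\<^sub>L 'u" and \<rho> :: real
  assumes a_ops: "\<And>n. a n \<in> bounded_ops"
    and sum_pos: "summable (\<lambda>n. norm (a (int n)))"
    and \<rho>: "0 < \<rho>" "\<rho> < 1"
    and trunc: "eventually (\<lambda>N. \<forall>t. norm (\<Sum>n\<in>{- int N..int N}. cis (real_of_int n * t) *\<^sub>C a n) \<le> \<rho>) sequentially"
begin

text \<open>With \<open>u l\<close> as the coefficient of \<open>z^(-l)\<close>, this multiplies by
  the symbol and drops the positive powers of \<open>z\<close>; hence the index \<open>l - m\<close>
  instead of \<open>m - l\<close>.\<close>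

definition toep :: "(nat \<Rightarrow> 'u) \<Rightarrow> nat \<Rightarrow> 'u" where
  "toep u m = (\<Sum>l. a (int l - int m) (u l))"

text \<open>After the reflection \<open>l\<close> to \<open>-l\<close> the section is part of a
  Laurent multiplication, and \<open>N\<close> is large enough to contain all differences of the
  indices involved.\<close>

lemma finite_section_bound:
  "(\<Sum>m<M. (norm (\<Sum>l<L. a (int l - int m) (u l)))\<^sup>2) \<le> \<rho>\<^sup>2 * (\<Sum>l<L. (norm (u l))\<^sup>2)"
proof -
  obtain N0 where N0: "\<And>N. N \<ge> N0 \<Longrightarrow> \<forall>t. norm (\<Sum>n\<in>{- int N..int N}. cis (real_of_int n * t) *\<^sub>C a n) \<le> \<rho>"
    using trunc by (auto simp: eventually_sequentially)
  define N where "N = N0 + L + M"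
  define neg where "neg X = (\<lambda>l. - int l) ` {..<X}" for X
  have inj: "inj_on (\<lambda>l. - int l) X" for X by (auto simp: inj_on_def)
  have "(\<Sum>k\<in>neg M. (norm (\<Sum>j\<in>neg L. a (k - j) (u (nat (- j)))))\<^sup>2)
      \<le> \<rho>\<^sup>2 * (\<Sum>j\<in>neg L. (norm (u (nat (- j))))\<^sup>2)"
  proof (rule laurent_multiplication_bound[where I = "{- int N..int N}"])
    show "norm (\<Sum>n\<in>{- int N..int N}. cis (real_of_int n * t) *\<^sub>C a n) \<le> \<rho>" for t
      using N0[of N] by (simp add: N_def)
  qed (auto simp: neg_def N_def a_ops)
  then show ?thesis
    by (simp add: neg_def sum.reindex[OF inj] o_def algebra_simps)
qed

text \<open>Only the finitely many \<open>l < m\<close> give negative indices.\<close>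

lemma summable_shift: "summable (\<lambda>l. norm (a (int l - int m)))"
  using summable_iff_shift[of "\<lambda>l. norm (a (int l - int m))" m] sum_pos by simp

lemma toep_summable:
  assumes "\<And>l. norm (u l) \<le> b"
  shows "summable (\<lambda>l. a (int l - int m) (u l))"
    and "norm (toep u m) \<le> (\<Sum>l. norm (a (int l - int m))) * b"
proof -
  have s: "summable (\<lambda>l. norm (a (int l - int m)) * b)"
    by (rule summable_mult2[OF summable_shift])
  have le: "norm (a (int l - int m) (u l)) \<le> norm (a (int l - int m)) * b" for l
    by (rule order_trans[OF norm_blinfun]) (simp add: mult_left_mono assms)
  have s': "summable (\<lambda>l. norm (a (int l - int m) (u l)))"
    by (rule summable_comparison_test[OF _ s]) (simp add: le)
  then show "summable (\<lambda>l. a (int l - int m) (u l))" by (rule summable_norm_cancel)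
  have "norm (toep u m) \<le> (\<Sum>l. norm (a (int l - int m) (u l)))"
    unfolding toep_def by (rule summable_norm[OF s'])
  also have "\<dots> \<le> (\<Sum>l. norm (a (int l - int m)) * b)" by (rule suminf_le[OF le s' s])
  finally show "norm (toep u m) \<le> (\<Sum>l. norm (a (int l - int m))) * b"
    by (simp add: suminf_mult2[OF summable_shift])
qed

lemma l2_bounded:
  fixes u :: "nat \<Rightarrow> 'b::real_normed_vector"
  assumes "summable (\<lambda>l. (norm (u l))\<^sup>2)"
  shows "norm (u l) \<le> sqrt (\<Sum>l. (norm (u l))\<^sup>2)"
proof (rule real_le_rsqrt)
  show "(norm (u l))\<^sup>2 \<le> (\<Sum>l. (norm (u l))\<^sup>2)"
    using sum_le_suminf[OF assms, of "{l}"] by simp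
qed

text \<open>The bound for finite sections survives \<open>L\<close> tending to infinity for each
  fixed \<open>M\<close>, and its right side does not depend on \<open>M\<close>.\<close>

lemma toep_l2:
  assumes u: "summable (\<lambda>l. (norm (u l))\<^sup>2)"
  shows "summable (\<lambda>m. (norm (toep u m))\<^sup>2)"
    and "(\<Sum>m. (norm (toep u m))\<^sup>2) \<le> \<rho>\<^sup>2 * (\<Sum>l. (norm (u l))\<^sup>2)"
proof -
  have le: "(\<Sum>m<M. (norm (toep u m))\<^sup>2) \<le> \<rho>\<^sup>2 * (\<Sum>l. (norm (u l))\<^sup>2)" for M
  proof (rule LIMSEQ_le_const2)
    show "(\<lambda>L. \<Sum>m<M. (norm (\<Sum>l<L. a (int l - int m) (u l)))\<^sup>2) \<longlonglongrightarrow> (\<Sum>m<M. (norm (toep u m))\<^sup>2)"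
      unfolding toep_def
      by (intro tendsto_sum tendsto_power tendsto_norm summable_LIMSEQ toep_summable(1)[OF l2_bounded[OF u]])
    have "(\<Sum>m<M. (norm (\<Sum>l<L. a (int l - int m) (u l)))\<^sup>2) \<le> \<rho>\<^sup>2 * (\<Sum>l. (norm (u l))\<^sup>2)" for L
      by (rule order_trans[OF finite_section_bound])
        (intro mult_left_mono sum_le_suminf u, auto)
    then show "\<exists>N. \<forall>L\<ge>N. (\<Sum>m<M. (norm (\<Sum>l<L. a (int l - int m) (u l)))\<^sup>2) \<le> \<rho>\<^sup>2 * (\<Sum>l. (norm (u l))\<^sup>2)"
      by blast
  qed
  show s: "summable (\<lambda>m. (norm (toep u m))\<^sup>2)"
    by (rule summableI_nonneg_bounded[OF _ le]) simp
  show "(\<Sum>m. (norm (toep u m))\<^sup>2) \<le> \<rho>\<^sup>2 * (\<Sum>l. (norm (u l))\<^sup>2)"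
    by (rule suminf_le_const[OF s le])
qed

text \<open>A solution satisfies \<open>toep u = - u\<close>, which a strict contraction permits
  only for zero.\<close>

lemma toep_injective:
  assumes u: "summable (\<lambda>l. (norm (u l))\<^sup>2)" and eq: "\<And>m. u m + toep u m = 0"
  shows "u m = 0"
proof -
  have "norm (toep u m) = norm (u m)" for m
    using eq[of m] by (metis add_eq_0_iff norm_minus_cancel)
  then have "(\<Sum>l. (norm (u l))\<^sup>2) \<le> \<rho>\<^sup>2 * (\<Sum>l. (norm (u l))\<^sup>2)"
    using toep_l2(2)[OF u] by simp
  moreover have "\<rho>\<^sup>2 < 1" using \<rho> by (simp add: power_less_one_iff)
  moreover have "(\<Sum>l. (norm (u l))\<^sup>2) \<ge> 0" by (rule suminf_nonneg[OF u]) simp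
  ultimately have "(\<Sum>l. (norm (u l))\<^sup>2) = 0"
    using mult_strict_right_mono[of "\<rho>\<^sup>2" 1 "\<Sum>l. (norm (u l))\<^sup>2"] by linarith
  then show ?thesis using suminf_eq_zero_iff[OF u] by simp
qed

text \<open>
  The Neumann series is controlled in \<open>\<ell>\<^sup>2\<close> but summed in the supremum norm, which dispenses with
  the completeness of \<open>\<ell>\<^sup>2\<close>.
\<close>

lemma toep_solve:
  assumes g: "summable (\<lambda>l. (norm (g l))\<^sup>2)"
  obtains u where "\<And>m. u m + toep u m = g m"
    and "\<And>m. norm (u m) \<le> sqrt (\<Sum>l. (norm (g l))\<^sup>2) / (1 - \<rho>)"
proof -
  define b where "b = sqrt (\<Sum>l. (norm (g l))\<^sup>2)"
  have b0: "b \<ge> 0" and b2: "b\<^sup>2 = (\<Sum>l. (norm (g l))\<^sup>2)"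
    unfolding b_def using suminf_nonneg[OF g] by auto
  \<comment> \<open>\<open>d k\<close> is the Neumann term \<open>(-T)^k g\<close>; its square norm,
    and hence each entry, is controlled by \<open>\<rho> ^ k * b\<close>.\<close>
  define d where "d k = ((\<lambda>v m. - toep v m) ^^ k) g" for k
  have d_Suc: "d (Suc k) m = - toep (d k) m" for k m by (simp add: d_def)
  have d: "summable (\<lambda>l. (norm (d k l))\<^sup>2) \<and> (\<Sum>l. (norm (d k l))\<^sup>2) \<le> (\<rho> ^ k * b)\<^sup>2" for k
  proof (induction k)
    case 0
    then show ?case using g by (simp add: d_def b2)
  next
    case (Suc k)
    have "(\<Sum>l. (norm (d (Suc k) l))\<^sup>2) \<le> \<rho>\<^sup>2 * (\<Sum>l. (norm (d k l))\<^sup>2)"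
      using toep_l2(2)[of "d k"] Suc by (simp add: d_Suc)
    also have "\<dots> \<le> \<rho>\<^sup>2 * (\<rho> ^ k * b)\<^sup>2" using Suc by (intro mult_left_mono) auto
    finally show ?case using toep_l2(1)[of "d k"] Suc by (simp add: d_Suc power_mult_distrib ac_simps)
  qed
  have dn: "norm (d k m) \<le> \<rho> ^ k * b" for k m
  proof -
    have "norm (d k m) \<le> sqrt (\<Sum>l. (norm (d k l))\<^sup>2)" by (rule l2_bounded) (use d in auto)
    also have "\<dots> \<le> \<rho> ^ k * b" by (rule real_le_lsqrt) (use d \<rho> b0 in auto)
    finally show ?thesis .
  qed
  have gs: "(\<lambda>k. \<rho> ^ (k + K) * b) sums (\<rho> ^ K * b / (1 - \<rho>))" for K
    using sums_mult2[OF geometric_sums[of \<rho>], of "\<rho> ^ K * b"] \<rho> by (simp add: power_add mult.assoc)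
  have ds: "summable (\<lambda>k. d (k + K) m)" for K m
    by (rule summable_comparison_test[OF _ sums_summable[OF gs]]) (use dn in auto)
  have tail: "norm (\<Sum>k. d (k + K) m) \<le> \<rho> ^ K * b / (1 - \<rho>)" for K m
  proof -
    have s: "summable (\<lambda>k. norm (d (k + K) m))"
      by (rule summable_comparison_test[OF _ sums_summable[OF gs]]) (use dn in auto)
    show ?thesis
      using order_trans[OF summable_norm[OF s] suminf_le[OF dn s sums_summable[OF gs]]]
      by (simp add: sums_unique[OF gs])
  qed
  define u where "u m = (\<Sum>k. d k m)" for m
  define s where "s K m = (\<Sum>k<K. d k m)" for K m
  have u_s: "u m - s K m = (\<Sum>k. d (k + K) m)" for K m
    using suminf_split_initial_segment[OF ds[of 0, simplified], of m K] by (simp add: u_def s_def)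
  have un: "norm (u m) \<le> b / (1 - \<rho>)" for m using tail[of 0 m] by (simp add: u_def)
  have sn: "norm (s K m) \<le> K * b" for K m
  proof -
    have "norm (s K m) \<le> (\<Sum>k<K. b)"
      unfolding s_def
    proof (rule sum_norm_le)
      fix k
      have "\<rho> ^ k * b \<le> 1 * b" using \<rho> b0 by (intro mult_right_mono power_le_one) auto
      then show "norm (d k m) \<le> b" using dn[of k m] by simp
    qed
    then show ?thesis by simp
  qed
  have "u m + toep u m = g m" for m
  proof -
    define Z where "Z = (\<Sum>l. norm (a (int l - int m)))"
    \<comment> \<open>Applying \<open>- toep\<close> shifts the terms by one, so the partial sum
      reappears without its first term \<open>g\<close>.\<close>
    have ts: "toep (s K) m = - (s (Suc K) m - g m)" for K
    proof -
      have "toep (s K) m = (\<Sum>k<K. toep (d k) m)"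
        unfolding toep_def s_def blinfun.sum_right
        by (rule suminf_sum) (rule toep_summable(1)[OF dn])
      also have "\<dots> = - (\<Sum>k<K. d (Suc k) m)"
        by (simp add: d_Suc sum_negf)
      also have "(\<Sum>k<K. d (Suc k) m) = s (Suc K) m - g m"
        unfolding s_def sum.lessThan_Suc_shift by (simp add: d_def)
      finally show ?thesis .
    qed
    have diff: "toep u m - toep (s K) m = toep (\<lambda>l. u l - s K l) m" for K
      unfolding toep_def blinfun.diff_right
      by (rule suminf_diff) (rule toep_summable(1)[OF un], rule toep_summable(1)[OF sn])
    \<comment> \<open>The tail is small uniformly in the entries, and row \<open>m\<close> of the
      Toeplitz matrix has the finite absolute sum \<open>Z\<close>.\<close>
    have "norm (toep (s K) m - toep u m) \<le> Z * (b / (1 - \<rho>)) * \<rho> ^ K" for K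
      unfolding norm_minus_commute[of "toep (s K) m"] diff u_s
      by (rule order_trans[OF toep_summable(2)[OF tail]]) (simp add: Z_def ac_simps)
    moreover have "(\<lambda>K. Z * (b / (1 - \<rho>)) * \<rho> ^ K) \<longlonglongrightarrow> 0"
      using tendsto_mult_right_zero[OF LIMSEQ_realpow_zero[of \<rho>]] \<rho> by simp
    ultimately have "(\<lambda>K. toep (s K) m - toep u m) \<longlonglongrightarrow> 0"
      by (intro Lim_null_comparison[of "\<lambda>K. toep (s K) m - toep u m"]) auto
    then have "(\<lambda>K. toep (s K) m) \<longlonglongrightarrow> toep u m" by (simp add: LIM_zero_iff)
    moreover have "(\<lambda>K. s K m) \<longlonglongrightarrow> u m"
      unfolding u_def s_def by (rule summable_LIMSEQ[OF ds[of 0, simplified]])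
    then have "(\<lambda>K. toep (s K) m) \<longlonglongrightarrow> - (u m - g m)"
      unfolding ts by (intro tendsto_intros LIMSEQ_Suc)
    ultimately have "toep u m = - (u m - g m)" by (rule LIMSEQ_unique)
    then show ?thesis by simp
  qed
  then show ?thesis using that[of u] un by (simp add: b_def)
qed

end


section \<open>Resolvents of dichotomous operators\<close>

text \<open>A factor of modulus at most 1 preserves summability of the powers, so the circle itself
  is included.\<close>

lemma neumann_scaled:
  fixes T :: "'a::{complex_normed_vector, banach} \<Rightarrow>\<^sub>L 'a"
  assumes T: "T \<in> bounded_ops" and sm: "summable (\<lambda>n. norm (opow T n))" and z: "norm z \<le> 1"
  shows "is_op_inverse (id_blinfun - z *\<^sub>C T) (\<Sum>n. z ^ n *\<^sub>C opow T n)"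
    and "summable (\<lambda>n. z ^ n *\<^sub>C opow T n)"
proof -
  have s: "summable (\<lambda>n. norm (opow (z *\<^sub>C T) n))"
  proof (rule summable_comparison_test[OF _ sm], intro exI allI impI)
    fix n :: nat
    show "norm (norm (opow (z *\<^sub>C T) n)) \<le> norm (opow T n)"
      using mult_right_mono[OF power_le_one[OF norm_ge_zero z, of n] norm_ge_zero[of "opow T n"]]
      by (simp add: opow_scaleC[OF T] norm_scaleC norm_power)
  qed
  show "is_op_inverse (id_blinfun - z *\<^sub>C T) (\<Sum>n. z ^ n *\<^sub>C opow T n)"
    using neumann_series[OF _ s] T by (simp add: opow_scaleC[OF T])
  show "summable (\<lambda>n. z ^ n *\<^sub>C opow T n)"
    using summable_norm_cancel[OF s] by (simp add: opow_scaleC[OF T])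
qed

lemma suminf_shift_tendsto_zero:
  fixes f :: "nat \<Rightarrow> 'a::real_normed_vector"
  assumes "summable f"
  shows "(\<lambda>N. \<Sum>n. f (n + N)) \<longlonglongrightarrow> 0"
  using tendsto_diff[OF tendsto_const[of "suminf f"] summable_LIMSEQ[OF assms]]
  by (simp add: suminf_minus_initial_segment[OF assms])

text \<open>The bound does not involve the weights \<open>c\<close>; with powers of \<open>z\<close>
  as weights this makes convergence uniform on the circle.\<close>

lemma norm_suminf_diff_partial_le:
  fixes f :: "nat \<Rightarrow> 'a::{complex_normed_vector, banach}"
  assumes f: "summable (\<lambda>n. norm (f n))" and c: "\<And>n. norm (c n) \<le> 1"
  shows "norm ((\<Sum>n. c n *\<^sub>C f n) - (\<Sum>n<N. c n *\<^sub>C f n)) \<le> (\<Sum>n. norm (f (n + N)))"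
proof -
  have le: "norm (c n *\<^sub>C f n) \<le> norm (f n)" for n
    using mult_right_mono[OF c norm_ge_zero] by (simp add: norm_scaleC)
  have s: "summable (\<lambda>n. norm (c n *\<^sub>C f n))"
    by (rule summable_comparison_test[OF _ f]) (use le in auto)
  have "(\<Sum>n. c n *\<^sub>C f n) - (\<Sum>n<N. c n *\<^sub>C f n) = (\<Sum>n. c (n + N) *\<^sub>C f (n + N))"
    by (rule suminf_minus_initial_segment[OF summable_norm_cancel[OF s], symmetric])
  also have "norm \<dots> \<le> (\<Sum>n. norm (c (n + N) *\<^sub>C f (n + N)))"
    by (rule summable_norm[OF summable_ignore_initial_segment[OF s]])
  also have "\<dots> \<le> (\<Sum>n. norm (f (n + N)))"
    by (rule suminf_le[OF le summable_ignore_initial_segment[OF s] summable_ignore_initial_segment[OF f]])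
  finally show ?thesis .
qed

lemma summable_norm_square:
  fixes f :: "nat \<Rightarrow> 'a::real_normed_vector"
  assumes "summable (\<lambda>n. norm (f n))"
  shows "summable (\<lambda>n. (norm (f n))\<^sup>2)"
proof (rule summable_comparison_test[OF _ summable_mult[OF assms]], intro exI allI impI)
  fix n :: nat
  have "norm (f n) \<le> (\<Sum>n. norm (f n))"
    using sum_le_suminf[OF assms, of "{n}"] by simp
  then show "norm ((norm (f n))\<^sup>2) \<le> (\<Sum>n. norm (f n)) * norm (f n)"
    by (simp add: power2_eq_square mult_right_mono)
qed

lemma op_invertible_inverse_arg:
  assumes "T \<in> bounded_ops" "z \<noteq> 0"
  shows "op_invertible (id_blinfun - z *\<^sub>C T) \<longleftrightarrow> op_invertible (inverse z *\<^sub>C id_blinfun - T)"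
proof -
  have e: "id_blinfun - z *\<^sub>C T = z *\<^sub>C (inverse z *\<^sub>C id_blinfun - T)"
    "inverse z *\<^sub>C id_blinfun - T = inverse z *\<^sub>C (id_blinfun - z *\<^sub>C T)"
    using assms(2) by (simp_all add: complex_vector.scale_right_diff_distrib scaleC_scaleC)
  show ?thesis
  proof
    assume "op_invertible (id_blinfun - z *\<^sub>C T)"
    then show "op_invertible (inverse z *\<^sub>C id_blinfun - T)"
      unfolding e(2) using assms
      by (intro op_invertibleI[OF is_op_inverse_scaleC[OF is_op_inverse_op_inv]]) auto
  next
    assume "op_invertible (inverse z *\<^sub>C id_blinfun - T)"
    then show "op_invertible (id_blinfun - z *\<^sub>C T)"
      unfolding e(1) using assms
      by (intro op_invertibleI[OF is_op_inverse_scaleC[OF is_op_inverse_op_inv]]) auto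
  qed
qed

section \<open>Stable and antistable parts of the resolvent\<close>

context dichotomy_splitting
begin

lemma A_C: "blinfun_apply A (c *\<^sub>C x) = c *\<^sub>C blinfun_apply A x"
  and P_C: "blinfun_apply P (c *\<^sub>C x) = c *\<^sub>C blinfun_apply P x"
  and Q_C: "blinfun_apply Q (c *\<^sub>C x) = c *\<^sub>C blinfun_apply Q x"
  using A_ops P_ops Q_ops by (simp_all add: bounded_opsD)

text \<open>This is \<open>A^n P\<close>, written through powers of \<open>A o\<^sub>L P\<close>
  because the summability assumption concerns those.\<close>

definition fwd :: "nat \<Rightarrow> 'a \<Rightarrow>\<^sub>L 'a" where "fwd n = opow (A o\<^sub>L P) n o\<^sub>L P"

lemma P_opow: "P (opow (A o\<^sub>L P) n x) = opow (A o\<^sub>L P) n (P x)"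
  by (induction n) (auto simp: P_A P_P)

lemma fwd_0 [simp]: "fwd 0 = P"
  by (auto intro!: blinfun_eqI simp: fwd_def)

lemma P_fwd: "P (fwd n x) = fwd n x"
  by (simp add: fwd_def P_opow P_P)

lemma A_fwd: "A (fwd n x) = fwd (Suc n) x"
  using P_fwd[of n x] by (simp add: fwd_def)

lemma fwd_A: "fwd n (A x) = fwd (Suc n) x"
  using opow_commute[of "A o\<^sub>L P" n "P x"] by (simp add: fwd_def P_A P_P P_opow)

lemma fwd_ops: "fwd n \<in> bounded_ops"
  using A_ops P_ops by (auto simp: fwd_def)

lemma fwd_summable: "summable (\<lambda>n. norm (fwd n))"
  by (rule summable_comparison_test[OF _ summable_mult2[OF AP_summable, of "norm P"]])
    (auto simp: fwd_def norm_blinfun_compose)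

lemma P_opow_Q: "P (opow Q n x) = (if n = 0 then P x else 0)"
  by (cases n) (auto simp: P_Q)

lemma opow_Q_P: "opow Q (Suc n) (P x) = 0"
  by (induction n) (auto simp: Q_P blinfun.zero_right)

lemma A_opow_Q: "A (opow Q (Suc n) x) = opow Q n x - (if n = 0 then P x else 0)"
  by (simp add: A_Q P_opow_Q)

text \<open>\<open>P (y m)\<close> equals \<open>fwd n\<close> applied to \<open>y (m + n)\<close>
  for every \<open>n\<close>; the orbit is bounded while \<open>fwd n\<close> tends to zero.\<close>

lemma backward_orbit_bounded:
  assumes step: "\<And>m. A (y (Suc m)) = y m" and bound: "\<And>m. norm (y m) \<le> b"
  shows "P (y m) = 0"
proof -
  have "P (y m) = fwd n (y (m + n))" for n
  proof (induction n)
    case (Suc n)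
    then show ?case using step[of "m + n"] fwd_A[of n "y (Suc (m + n))"] by simp
  qed simp
  then have "norm (P (y m)) \<le> norm (fwd n) * b" for n
    by (metis bound mult_left_mono norm_blinfun norm_ge_zero order_trans)
  moreover have "(\<lambda>n. norm (fwd n) * b) \<longlonglongrightarrow> 0"
    using tendsto_mult_left_zero[OF summable_LIMSEQ_zero[OF fwd_summable]] .
  ultimately have "norm (P (y m)) \<le> 0"
    by (auto intro!: LIMSEQ_le_const simp del: norm_le_zero_iff)
  then show ?thesis by simp
qed

lemma invertible_stable_part:
  assumes "norm z \<le> 1"
  shows "op_invertible (id_blinfun - z *\<^sub>C (A o\<^sub>L P))"
  using neumann_scaled(1)[OF _ AP_summable assms] A_ops P_ops by (auto intro: op_invertibleI)

lemma invertible_antistable_part: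
  assumes "norm z \<ge> 1"
  shows "op_invertible (z *\<^sub>C id_blinfun - Q)"
proof -
  have z: "z \<noteq> 0" using assms by auto
  have "norm (inverse z) \<le> 1" using assms by (simp add: norm_inverse inverse_le_1_iff)
  then have "op_invertible (id_blinfun - inverse z *\<^sub>C Q)"
    using neumann_scaled(1)[OF Q_ops Q_summable] by (auto intro: op_invertibleI)
  then show ?thesis
    using op_invertible_inverse_arg[OF Q_ops, of "inverse z"] z by simp
qed

text \<open>The solution of \<open>y - z A P y = P x\<close> stays in the range of \<open>P\<close>,
  where \<open>A P\<close> and \<open>A\<close> agree. The right side makes sense on the whole
  closed disc, which supplies the extensions of \<open>Wp\<close> and its inverse.\<close>

lemma resolvent_stable_part:
  assumes R: "op_invertible (id_blinfun - z *\<^sub>C A)"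
    and U: "op_invertible (id_blinfun - z *\<^sub>C (A o\<^sub>L P))"
  shows "op_inv (id_blinfun - z *\<^sub>C A) (P x) = op_inv (id_blinfun - z *\<^sub>C (A o\<^sub>L P)) (P x)"
proof -
  let ?U = "op_inv (id_blinfun - z *\<^sub>C (A o\<^sub>L P))"
  have Ux: "?U y - z *\<^sub>C A (P (?U y)) = y" for y
    using op_inv_apply(2)[OF U, of y] by (simp add: blinfun.bilinear_simps)
  have "P (?U (P x)) - z *\<^sub>C A (P (?U (P x))) = P x"
    using arg_cong[OF Ux[of "P x"], of "blinfun_apply P"] by (simp add: blinfun.bilinear_simps P_A P_P P_C)
  then have "P (?U (P x)) = ?U (P x)"
    using Ux[of "P x"] by (metis diff_eq_eq)
  then have "(id_blinfun - z *\<^sub>C A) (?U (P x)) = P x"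
    using Ux[of "P x"] by (simp add: blinfun.bilinear_simps)
  then show ?thesis using op_inv_apply(1)[OF R] by metis
qed

text \<open>On the kernel of \<open>P\<close> the operator \<open>A\<close> is the inverse of
  \<open>Q\<close>, and \<open>(I - z Q^(-1))^(-1) = - Q (z I - Q)^(-1)\<close>. The right side is
  available for all \<open>z\<close> of modulus at least 1.\<close>

lemma resolvent_antistable_part:
  assumes R: "op_invertible (id_blinfun - z *\<^sub>C A)"
    and V: "op_invertible (z *\<^sub>C id_blinfun - Q)"
  shows "op_inv (id_blinfun - z *\<^sub>C A) (x - P x) = - Q (op_inv (z *\<^sub>C id_blinfun - Q) x)"
proof -
  let ?V = "op_inv (z *\<^sub>C id_blinfun - Q)"
  have Vx: "z *\<^sub>C ?V x - Q (?V x) = x"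
    using op_inv_apply(2)[OF V, of x] by (simp add: blinfun.bilinear_simps)
  have "P x = z *\<^sub>C P (?V x)"
    using arg_cong[OF Vx, of "blinfun_apply P"] by (simp add: blinfun.bilinear_simps P_Q P_C)
  then have "(id_blinfun - z *\<^sub>C A) (- Q (?V x)) = x - P x"
    using Vx by (simp add: blinfun.bilinear_simps A_Q complex_vector.scale_right_diff_distrib algebra_simps)
  then show ?thesis using op_inv_apply(1)[OF R] by metis
qed

lemma resolvent_expansion:
  assumes z: "norm z = 1" and R: "op_invertible (id_blinfun - z *\<^sub>C A)"
  shows "op_inv (id_blinfun - z *\<^sub>C A) =
    (\<Sum>n. z ^ n *\<^sub>C fwd n) - (\<Sum>n. inverse z ^ Suc n *\<^sub>C opow Q (Suc n))"
proof (rule blinfun_eqI)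
  fix x
  have z0: "z \<noteq> 0" using z by auto
  have zi: "norm (inverse z) \<le> 1" using z by (simp add: norm_inverse)
  have AP: "A o\<^sub>L P \<in> bounded_ops" using A_ops P_ops by auto
  note N1 = neumann_scaled[OF AP AP_summable order_eq_refl[OF z]]
  note N2 = neumann_scaled[OF Q_ops Q_summable zi]
  have U: "op_invertible (id_blinfun - z *\<^sub>C (A o\<^sub>L P))" and V: "op_invertible (z *\<^sub>C id_blinfun - Q)"
    using z by (auto intro: invertible_stable_part invertible_antistable_part)
  have fs: "summable (\<lambda>n. z ^ n *\<^sub>C fwd n)"
    by (rule summable_norm_cancel) (simp add: norm_scaleC norm_power z fwd_summable)
  have Qs: "summable (\<lambda>n. inverse z ^ Suc n *\<^sub>C opow Q (Suc n))"
    using N2(2) by (subst summable_Suc_iff)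
  have "op_inv (id_blinfun - z *\<^sub>C A) x = op_inv (id_blinfun - z *\<^sub>C A) (P x) + op_inv (id_blinfun - z *\<^sub>C A) (x - P x)"
    by (simp add: blinfun.bilinear_simps)
  moreover have "op_inv (id_blinfun - z *\<^sub>C A) (P x) = (\<Sum>n. z ^ n *\<^sub>C fwd n) x"
    unfolding resolvent_stable_part[OF R U] op_inv_eqI[OF N1(1)]
    using summable_apply(2)[OF fs, of x] by (simp add: summable_apply(2)[OF N1(2), symmetric] fwd_def)
  moreover have "op_inv (id_blinfun - z *\<^sub>C A) (x - P x) = - (\<Sum>n. inverse z ^ Suc n *\<^sub>C opow Q (Suc n)) x"
  proof -
    have "is_op_inverse (z *\<^sub>C (id_blinfun - inverse z *\<^sub>C Q)) (inverse z *\<^sub>C (\<Sum>n. inverse z ^ n *\<^sub>C opow Q n))"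
      using Q_ops z0 by (intro is_op_inverse_scaleC N2) auto
    then have "op_inv (z *\<^sub>C id_blinfun - Q) = inverse z *\<^sub>C (\<Sum>n. inverse z ^ n *\<^sub>C opow Q n)"
      using z0 by (intro op_inv_eqI) (simp add: complex_vector.scale_right_diff_distrib scaleC_scaleC)
    then have "Q (op_inv (z *\<^sub>C id_blinfun - Q) x) = inverse z *\<^sub>C Q (\<Sum>n. inverse z ^ n *\<^sub>C opow Q n x)"
      by (simp add: Q_C summable_apply(2)[OF N2(2), symmetric])
    also have "\<dots> = (\<Sum>n. inverse z *\<^sub>C Q (inverse z ^ n *\<^sub>C opow Q n x))"
      using summable_apply(1)[OF N2(2), of x]
      by (simp add: bounded_linear.suminf[OF blinfun.bounded_linear_right]
          bounded_linear.suminf[OF bounded_linear_scaleC_right] bounded_linear.summable[OF blinfun.bounded_linear_right])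
    also have "\<dots> = (\<Sum>n. inverse z ^ Suc n *\<^sub>C opow Q (Suc n)) x"
      using summable_apply(2)[OF Qs, of x] by (simp add: Q_C scaleC_scaleC)
    finally show ?thesis unfolding resolvent_antistable_part[OF R V] by simp
  qed
  ultimately show "op_inv (id_blinfun - z *\<^sub>C A) x =
    ((\<Sum>n. z ^ n *\<^sub>C fwd n) - (\<Sum>n. inverse z ^ Suc n *\<^sub>C opow Q (Suc n))) x"
    by (simp add: blinfun.diff_left)
qed

end


section \<open>State space realizations and the direct sum decomposition\<close>

locale transfer_function = dichotomy_splitting A P Q
  for A P Q :: "'x::complex_hilbert_space \<Rightarrow>\<^sub>L 'x" +
  fixes B :: "'u::complex_hilbert_space \<Rightarrow>\<^sub>L 'x" and C :: "'x \<Rightarrow>\<^sub>L 'u" and D :: "'u \<Rightarrow>\<^sub>L 'u" and r :: real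
  assumes B_ops: "B \<in> bounded_ops" and C_ops: "C \<in> bounded_ops" and D_ops: "D \<in> bounded_ops"
    and r: "r < 1"
    and circle_inv: "\<And>z. norm z = 1 \<Longrightarrow> op_invertible (id_blinfun - z *\<^sub>C A)"
    and circle_bound: "\<And>z. norm z = 1 \<Longrightarrow> norm (D + z *\<^sub>C (C o\<^sub>L op_inv (id_blinfun - z *\<^sub>C A) o\<^sub>L B)) \<le> r"
begin

section \<open>Fourier coefficients of the transfer function\<close>

lemma r_nonneg: "0 \<le> r"
  using order_trans[OF norm_ge_zero circle_bound[of 1]] by simp

text \<open>The Fourier coefficients of \<open>D + z C (I - zA)\<^sup>-\<^sup>1 B\<close> on the circle.\<close>

definition coef :: "int \<Rightarrow> 'u \<Rightarrow>\<^sub>L 'u" where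
  "coef n = (if n > 0 then C o\<^sub>L fwd (nat n - 1) o\<^sub>L B
    else (if n = 0 then D else 0) - (C o\<^sub>L opow Q (Suc (nat (- n))) o\<^sub>L B))"

lemma coef_pos: "coef (int n + 1) = C o\<^sub>L fwd n o\<^sub>L B"
  by (simp add: coef_def nat_add_distrib)

lemma coef_nonpos: "coef (- int n) = (if n = 0 then D else 0) - (C o\<^sub>L opow Q (Suc n) o\<^sub>L B)"
  by (simp add: coef_def del: opow.simps)

lemma coef_ops: "coef n \<in> bounded_ops"
  using B_ops C_ops D_ops Q_ops by (auto simp: coef_def fwd_ops simp del: opow.simps)

text \<open>The leading factor \<open>z\<close> shifts all exponents by one: frequencies 1 to
  \<open>N\<close> take \<open>N\<close> forward terms, frequencies 0 down to \<open>-N\<close> take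
  \<open>N + 1\<close> backward terms.\<close>

lemma coef_partial_sum:
  "(\<Sum>n\<in>{- int N..int N}. cis (real_of_int n * t) *\<^sub>C coef n) = D + cis t *\<^sub>C (C o\<^sub>L
    ((\<Sum>n<N. cis t ^ n *\<^sub>C fwd n) - (\<Sum>n<Suc N. inverse (cis t) ^ Suc n *\<^sub>C opow Q (Suc n))) o\<^sub>L B)"
proof (induction N)
  case 0
  show ?case
    using coef_nonpos[of 0]
    by (auto intro!: blinfun_eqI simp: blinfun.bilinear_simps bounded_opsD[OF C_ops] scaleC_scaleC cis_mult)
next
  case (Suc N)
  let ?z = "cis t" and ?M = "Suc N"
  have e: "{- int ?M..int ?M} = insert (- int ?M) (insert (int N + 1) {- int N..int N})"
    by auto
  have p: "cis (real_of_int (int N + 1) * t) = ?z * ?z ^ N"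
    unfolding Complex.DeMoivre cis_mult by (rule arg_cong[of _ _ cis]) (simp add: algebra_simps)
  have q: "cis (real_of_int (- int ?M) * t) = ?z * inverse ?z ^ Suc (Suc N)"
    unfolding cis_inverse Complex.DeMoivre cis_mult by (rule arg_cong[of _ _ cis]) (simp add: algebra_simps)
  have "(\<Sum>n\<in>{- int ?M..int ?M}. cis (real_of_int n * t) *\<^sub>C coef n)
    = cis (real_of_int (- int ?M) * t) *\<^sub>C coef (- int ?M) + (cis (real_of_int (int N + 1) * t) *\<^sub>C coef (int N + 1)
      + (\<Sum>n\<in>{- int N..int N}. cis (real_of_int n * t) *\<^sub>C coef n))"
    unfolding e by (subst sum.insert; simp)
  note split = this[unfolded Suc p q]
  define S1 where "S1 = (\<Sum>n<N. ?z ^ n *\<^sub>C fwd n)"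
  define S2 where "S2 = (\<Sum>n<Suc N. inverse ?z ^ Suc n *\<^sub>C opow Q (Suc n))"
  define w X where "w = inverse ?z ^ Suc ?M" and "X = opow Q (Suc ?M)"
  have S1: "(\<Sum>n<?M. ?z ^ n *\<^sub>C fwd n) = S1 + ?z ^ N *\<^sub>C fwd N"
    by (simp only: S1_def sum.lessThan_Suc)
  have S2: "(\<Sum>n<Suc ?M. inverse ?z ^ Suc n *\<^sub>C opow Q (Suc n)) = S2 + w *\<^sub>C X"
    by (simp only: S2_def w_def X_def sum.lessThan_Suc)
  show ?case
    unfolding split S1 S2 unfolding S1_def[symmetric] S2_def[symmetric] w_def[symmetric]
      coef_pos coef_nonpos X_def[symmetric]
    by (rule blinfun_eqI) (simp add: blinfun.bilinear_simps bounded_opsD[OF C_ops] scaleC_scaleC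
        complex_vector.scale_right_diff_distrib scaleC_add_right)
qed

text \<open>The series tails vanish uniformly in \<open>t\<close>, so eventually their effect is
  below half of the gap \<open>1 - r\<close>. The resulting midpoint bound is positive even for
  \<open>r = 0\<close>.\<close>

lemma coef_partial_sum_bound:
  "eventually (\<lambda>N. \<forall>t. norm (\<Sum>n\<in>{- int N..int N}. cis (real_of_int n * t) *\<^sub>C coef n) \<le> (1 + r) / 2) sequentially"
proof -
  define tail where "tail N = (\<Sum>n. norm (fwd (n + N))) + (\<Sum>n. norm (opow Q (Suc (n + Suc N))))" for N
  have Qs: "summable (\<lambda>n. norm (opow Q (Suc n)))" using Q_summable by (subst summable_Suc_iff)
  have "tail \<longlonglongrightarrow> 0 + 0"
    unfolding tail_def
    using LIMSEQ_Suc[OF suminf_shift_tendsto_zero[OF Qs]]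
    by (intro tendsto_add suminf_shift_tendsto_zero fwd_summable)
  then have "(\<lambda>N. norm C * (tail N * norm B)) \<longlonglongrightarrow> norm C * (0 * norm B)"
    by (intro tendsto_intros) simp
  then have "eventually (\<lambda>N. norm C * (tail N * norm B) < (1 - r) / 2) sequentially"
    using r by (intro order_tendstoD(2)) auto
  then show ?thesis
  proof eventually_elim
    case (elim N)
    show ?case
    proof
      fix t
      let ?z = "cis t"
      define R where "R = op_inv (id_blinfun - ?z *\<^sub>C A)"
      define RN where "RN = (\<Sum>n<N. ?z ^ n *\<^sub>C fwd n) - (\<Sum>n<Suc N. inverse ?z ^ Suc n *\<^sub>C opow Q (Suc n))"
      have z: "norm ?z = 1" by simp
      have "R - RN = ((\<Sum>n. ?z ^ n *\<^sub>C fwd n) - (\<Sum>n<N. ?z ^ n *\<^sub>C fwd n)) -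
        ((\<Sum>n. inverse ?z ^ Suc n *\<^sub>C opow Q (Suc n)) - (\<Sum>n<Suc N. inverse ?z ^ Suc n *\<^sub>C opow Q (Suc n)))"
        unfolding R_def RN_def resolvent_expansion[OF z circle_inv[OF z]] by simp
      also have "norm \<dots> \<le> (\<Sum>n. norm (fwd (n + N))) + (\<Sum>n. norm (opow Q (Suc (n + Suc N))))"
      proof (rule norm_triangle_le_diff, rule add_mono)
        show "norm ((\<Sum>n. ?z ^ n *\<^sub>C fwd n) - (\<Sum>n<N. ?z ^ n *\<^sub>C fwd n)) \<le> (\<Sum>n. norm (fwd (n + N)))"
          by (rule norm_suminf_diff_partial_le[OF fwd_summable]) (simp add: norm_power)
        show "norm ((\<Sum>n. inverse ?z ^ Suc n *\<^sub>C opow Q (Suc n)) - (\<Sum>n<Suc N. inverse ?z ^ Suc n *\<^sub>C opow Q (Suc n)))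
            \<le> (\<Sum>n. norm (opow Q (Suc (n + Suc N))))"
          by (rule norm_suminf_diff_partial_le[OF Qs]) (simp add: norm_power norm_inverse norm_mult)
      qed
      finally have tail: "norm (R - RN) \<le> tail N" by (simp add: tail_def)
      have "(\<Sum>n\<in>{- int N..int N}. cis (real_of_int n * t) *\<^sub>C coef n)
          = (D + ?z *\<^sub>C (C o\<^sub>L R o\<^sub>L B)) - ?z *\<^sub>C (C o\<^sub>L (R - RN) o\<^sub>L B)"
        unfolding coef_partial_sum RN_def[symmetric]
        by (auto intro!: blinfun_eqI simp: blinfun.bilinear_simps complex_vector.scale_right_diff_distrib)
      also have "norm \<dots> \<le> r + norm C * (tail N * norm B)"
      proof (rule norm_triangle_le_diff, rule add_mono)
        show "norm (D + ?z *\<^sub>C (C o\<^sub>L R o\<^sub>L B)) \<le> r"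
          unfolding R_def by (rule circle_bound[OF z])
        have "norm (C o\<^sub>L (R - RN) o\<^sub>L B) \<le> norm (C o\<^sub>L (R - RN)) * norm B" by (rule norm_blinfun_compose)
        also have "\<dots> \<le> norm C * norm (R - RN) * norm B"
          by (intro mult_right_mono norm_blinfun_compose) auto
        also have "\<dots> \<le> norm C * tail N * norm B"
          by (intro mult_right_mono mult_left_mono tail) auto
        finally show "norm (?z *\<^sub>C (C o\<^sub>L (R - RN) o\<^sub>L B)) \<le> norm C * (tail N * norm B)"
          by (simp add: norm_scaleC mult.assoc)
      qed
      also have "\<dots> \<le> (1 + r) / 2" using elim by (simp add: field_simps)
      finally show "norm (\<Sum>n\<in>{- int N..int N}. cis (real_of_int n * t) *\<^sub>C coef n) \<le> (1 + r) / 2" .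
    qed
  qed
qed

sublocale toeplitz_contraction coef "(1 + r) / 2"
proof
  have "norm (coef (int (Suc n))) \<le> norm C * norm B * norm (fwd n)" for n
  proof -
    have "norm (C o\<^sub>L fwd n o\<^sub>L B) \<le> norm (C o\<^sub>L fwd n) * norm B" by (rule norm_blinfun_compose)
    also have "\<dots> \<le> norm C * norm (fwd n) * norm B"
      by (intro mult_right_mono norm_blinfun_compose) auto
    finally show ?thesis using coef_pos[of n] by (simp add: ac_simps)
  qed
  then have "summable (\<lambda>n. norm (coef (int (Suc n))))"
    by (intro summable_comparison_test[OF _ summable_mult[OF fwd_summable, of "norm C * norm B"]]) auto
  then show "summable (\<lambda>n. norm (coef (int n)))" by (subst (asm) summable_Suc_iff)
  show "0 < (1 + r) / 2" "(1 + r) / 2 < 1" using r r_nonneg by auto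
qed (rule coef_ops coef_partial_sum_bound)+

text \<open>The coefficient of \<open>z\<^sup>-\<^sup>m\<close> in \<open>- z (I - zA)\<^sup>-\<^sup>1 B \<Sum>\<^sub>l v\<^sub>l z\<^sup>-\<^sup>l\<^sup>-\<^sup>1\<close>.\<close>

definition state :: "(nat \<Rightarrow> 'u) \<Rightarrow> nat \<Rightarrow> 'x" where
  "state v m = (\<Sum>l<m. opow Q (m - l) (B (v l))) - (\<Sum>i. fwd i (B (v (m + i))))"

context
  fixes v :: "nat \<Rightarrow> 'u" and b :: real
  assumes v: "\<And>l. norm (v l) \<le> b"
begin

lemma b_nonneg: "0 \<le> b"
  using order_trans[OF norm_ge_zero v] .

lemma state_tail_summable: "summable (\<lambda>i. fwd i (B (v (m + i))))"
  and state_tail_bound: "norm (\<Sum>i. fwd i (B (v (m + i)))) \<le> (\<Sum>n. norm (fwd n)) * (norm B * b)"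
proof -
  have le: "norm (fwd i (B (v (m + i)))) \<le> norm (fwd i) * (norm B * b)" for i
    by (rule order_trans[OF norm_blinfun mult_left_mono])
      (auto intro: order_trans[OF norm_blinfun mult_left_mono] v)
  have s: "summable (\<lambda>i. norm (fwd i) * (norm B * b))" by (rule summable_mult2[OF fwd_summable])
  have s': "summable (\<lambda>i. norm (fwd i (B (v (m + i)))))"
    by (rule summable_comparison_test[OF _ s]) (use le in auto)
  show "summable (\<lambda>i. fwd i (B (v (m + i))))" using s' by (rule summable_norm_cancel)
  show "norm (\<Sum>i. fwd i (B (v (m + i)))) \<le> (\<Sum>n. norm (fwd n)) * (norm B * b)"
    using order_trans[OF summable_norm[OF s'] suminf_le[OF le s' s]] by (simp add: suminf_mult2[OF fwd_summable])
qed

lemma state_bound: "norm (state v m) \<le> ((\<Sum>n. norm (opow Q n)) + (\<Sum>n. norm (fwd n))) * (norm B * b)"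
proof -
  have "norm (\<Sum>l<m. opow Q (m - l) (B (v l))) \<le> (\<Sum>l<m. norm (opow Q (m - l)) * (norm B * b))"
  proof (rule sum_norm_le)
    fix l
    show "norm (opow Q (m - l) (B (v l))) \<le> norm (opow Q (m - l)) * (norm B * b)"
      by (rule order_trans[OF norm_blinfun mult_left_mono])
        (auto intro: order_trans[OF norm_blinfun mult_left_mono] v)
  qed
  also have "\<dots> = (\<Sum>l<m. norm (opow Q (m - l))) * (norm B * b)" by (simp add: sum_distrib_right)
  also have "(\<Sum>l<m. norm (opow Q (m - l))) = (\<Sum>n<m. norm (opow Q (Suc n)))"
    by (rule sum.reindex_bij_witness[of _ "\<lambda>n. m - Suc n" "\<lambda>l. m - Suc l"]) (auto simp: Suc_diff_Suc simp del: opow.simps)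
  also have "\<dots> \<le> (\<Sum>n<Suc m. norm (opow Q n))"
    unfolding sum.lessThan_Suc_shift by simp
  also have "\<dots> \<le> (\<Sum>n. norm (opow Q n))"
    by (rule sum_le_suminf[OF Q_summable]) auto
  finally have "norm (\<Sum>l<m. opow Q (m - l) (B (v l))) \<le> (\<Sum>n. norm (opow Q n)) * (norm B * b)"
    using b_nonneg by (simp add: mult_right_mono)
  then show ?thesis
    unfolding state_def distrib_right
    by (rule order_trans[OF norm_triangle_ineq4 add_mono[OF _ state_tail_bound]])
qed

text \<open>At index 0 the sum over the past is empty, and every forward term lies in the range of
  \<open>P\<close>.\<close>

lemma P_state_0: "P (state v 0) = state v 0"
proof -
  have "P (\<Sum>i. fwd i (B (v (0 + i)))) = (\<Sum>i. fwd i (B (v (0 + i))))"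
    using bounded_linear.suminf[OF blinfun.bounded_linear_right[of P] state_tail_summable[of 0]]
    by (simp add: P_fwd)
  then show ?thesis by (simp add: state_def blinfun.minus_right)
qed

text \<open>The past sum contributes the part of \<open>B (v m)\<close> in the kernel of
  \<open>P\<close>, the future sum the part in its range.\<close>

lemma state_step: "A (state v (Suc m)) = state v m + B (v m)"
proof -
  have q: "A (\<Sum>l<Suc m. opow Q (Suc m - l) (B (v l))) =
      (\<Sum>l<m. opow Q (m - l) (B (v l))) + (B (v m) - P (B (v m)))"
  proof -
    have "A (opow Q (Suc m - l) y) = opow Q (m - l) y" if "l < m" for l y
      using that A_opow_Q[of "m - l" y] by (simp add: Suc_diff_le)
    then show ?thesis by (simp add: blinfun.bilinear_simps A_Q)
  qed
  have "A (\<Sum>i. fwd i (B (v (Suc m + i)))) = (\<Sum>i. fwd (Suc i) (B (v (m + Suc i))))"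
    using bounded_linear.suminf[OF blinfun.bounded_linear_right[of A] state_tail_summable[of "Suc m"]]
    by (simp add: A_fwd)
  also have "\<dots> = (\<Sum>i. fwd i (B (v (m + i)))) - P (B (v m))"
    using suminf_split_head[OF state_tail_summable[of m]] by simp
  finally show ?thesis by (simp add: state_def blinfun.diff_right q del: sum.lessThan_Suc)
qed

text \<open>Row \<open>m\<close> of the Toeplitz operator is split after \<open>l = m\<close>: the
  terms up to there carry powers of \<open>Q\<close>, and \<open>D\<close> at \<open>l = m\<close>;
  the later ones carry \<open>fwd\<close>.\<close>

lemma state_output: "C (state v (Suc m)) = D (v m) - toep v m"
proof -
  have "(\<Sum>l<Suc m. coef (int l - int m) (v l)) =
      (\<Sum>l<Suc m. (if l = m then D (v m) else 0) - C (opow Q (Suc m - l) (B (v l))))"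
  proof (rule sum.cong[OF refl])
    fix l assume "l \<in> {..<Suc m}"
    then have l: "l \<le> m" by simp
    then have "coef (int l - int m) = coef (- int (m - l))" by (simp add: of_nat_diff)
    then show "coef (int l - int m) (v l) = (if l = m then D (v m) else 0) - C (opow Q (Suc m - l) (B (v l)))"
      using l unfolding coef_nonpos by (auto simp: blinfun.bilinear_simps Suc_diff_le simp del: opow.simps)
  qed
  also have "\<dots> = D (v m) - C (\<Sum>l<Suc m. opow Q (Suc m - l) (B (v l)))"
    unfolding sum_subtractf blinfun.sum_right by (simp add: sum.delta)
  finally have 1: "(\<Sum>l<Suc m. coef (int l - int m) (v l)) = D (v m) - C (\<Sum>l<Suc m. opow Q (Suc m - l) (B (v l)))" .
  have "int (i + Suc m) - int m = int i + 1" for i by simp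
  then have "(\<Sum>i. coef (int (i + Suc m) - int m) (v (i + Suc m))) = (\<Sum>i. C (fwd i (B (v (Suc m + i)))))"
    by (simp only: coef_pos) (simp add: add.commute)
  also have "\<dots> = C (\<Sum>i. fwd i (B (v (Suc m + i))))"
    by (rule bounded_linear.suminf[OF blinfun.bounded_linear_right state_tail_summable, symmetric])
  finally have tail: "(\<Sum>i. coef (int (i + Suc m) - int m) (v (i + Suc m)))
      = C (\<Sum>i. fwd i (B (v (Suc m + i))))" .
  have ts: "summable (\<lambda>l. coef (int l - int m) (v l))" by (rule toep_summable(1)[OF v])
  have "toep v m = C (\<Sum>i. fwd i (B (v (Suc m + i)))) + (\<Sum>l<Suc m. coef (int l - int m) (v l))"
    unfolding toep_def using suminf_split_initial_segment[OF ts, of "Suc m"] by (simp only: tail)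
  then show ?thesis unfolding 1 state_def by (simp add: blinfun.diff_right)
qed

end

end

section \<open>Complementarity of the two spectral subspaces\<close>

text \<open>\<open>Ei\<close> stands for \<open>(I + D)\<^sup>-\<^sup>1\<close> and the primed operators for those belonging to \<open>A\<^sup>\<times>\<close>.\<close>

locale closed_loop = transfer_function A P Q B C D r + cl: dichotomy_splitting A' P' Q'
  for A P Q A' P' Q' :: "'x::complex_hilbert_space \<Rightarrow>\<^sub>L 'x"
    and B :: "'u::complex_hilbert_space \<Rightarrow>\<^sub>L 'x" and C D r +
  fixes Ei :: "'u \<Rightarrow>\<^sub>L 'u"
  assumes Ei_left: "\<And>u. Ei (u + D u) = u" and Ei_right: "\<And>u. Ei u + D (Ei u) = u"
    and A'_eq: "\<And>x. A' x = A x - B (Ei (C x))"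
begin

text \<open>The free motion \<open>Q^m (x - P x)\<close> fixes the right side \<open>g\<close> of
  the Toeplitz equation, whose solution drives a bounded backward orbit \<open>k\<close> of
  \<open>A'\<close>. The witness is \<open>- k 0\<close>. That \<open>K\<close> does not depend on
  \<open>x\<close> later makes the projection bounded.\<close>

lemma subspaces_span:
  obtains K where "\<And>x. \<exists>y. P' y = 0 \<and> P (x - y) = x - y \<and> norm y \<le> K * norm x"
proof -
  define \<rho> where "\<rho> = (1 + r) / 2"
  have \<rho>: "\<rho> < 1" using r by (simp add: \<rho>_def)
  have Qs: "summable (\<lambda>n. norm (opow Q (Suc n)))" using Q_summable by (subst summable_Suc_iff)
  define q where "q = (\<Sum>n. norm (opow Q n))"
  define S2 where "S2 = (\<Sum>n. (norm (opow Q (Suc n)))\<^sup>2)"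
  \<comment> \<open>\<open>M * norm x\<close> bounds the entries of the Toeplitz solution: a bound
    for the square norm of \<open>g\<close>, divided by \<open>1 - \<rho>\<close>.\<close>
  define M where "M = sqrt ((norm C)\<^sup>2 * S2) / (1 - \<rho>)"
  define K where "K = (q + (\<Sum>n. norm (fwd n))) * (norm B * M) + q * (1 + norm P)"
  have Qn: "norm (opow Q n) \<le> q" for n
    unfolding q_def using sum_le_suminf[OF Q_summable, of "{n}"] by simp
  have "\<exists>y. P' y = 0 \<and> P (x - y) = x - y \<and> norm y \<le> K * norm x" for x
  proof -
    define g where "g m = - C (opow Q (Suc m) x)" for m
    have gle: "(norm (g m))\<^sup>2 \<le> ((norm C)\<^sup>2 * (norm x)\<^sup>2) * (norm (opow Q (Suc m)))\<^sup>2" for m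
    proof -
      have "norm (g m) \<le> norm C * (norm (opow Q (Suc m)) * norm x)"
        unfolding g_def norm_minus_cancel
        by (intro order_trans[OF norm_blinfun] mult_left_mono norm_blinfun norm_ge_zero)
      then have "(norm (g m))\<^sup>2 \<le> (norm C * (norm (opow Q (Suc m)) * norm x))\<^sup>2"
        by (rule power_mono) simp
      then show ?thesis by (simp add: power_mult_distrib ac_simps del: opow.simps)
    qed
    have s2: "summable (\<lambda>m. ((norm C)\<^sup>2 * (norm x)\<^sup>2) * (norm (opow Q (Suc m)))\<^sup>2)"
      by (intro summable_mult summable_norm_square Qs)
    have gs: "summable (\<lambda>m. (norm (g m))\<^sup>2)"
      by (rule summable_comparison_test[OF _ s2]) (use gle in auto)
    have "(\<Sum>m. (norm (g m))\<^sup>2) \<le> ((norm C)\<^sup>2 * (norm x)\<^sup>2) * S2"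
      using suminf_le[OF gle gs s2] unfolding S2_def
      by (simp only: suminf_mult[OF summable_norm_square[OF Qs]])
    from real_sqrt_le_mono[OF this]
    have "sqrt (\<Sum>m. (norm (g m))\<^sup>2) \<le> sqrt ((norm C)\<^sup>2 * S2) * norm x"
      by (simp add: real_sqrt_mult ac_simps)
    then have gM: "sqrt (\<Sum>m. (norm (g m))\<^sup>2) / (1 - \<rho>) \<le> M * norm x"
      using \<rho> unfolding M_def by (simp add: divide_right_mono)
    obtain u where u: "\<And>m. u m + toep u m = g m"
      and ub: "\<And>m. norm (u m) \<le> sqrt (\<Sum>l. (norm (g l))\<^sup>2) / (1 - (1 + r) / 2)"
      using toep_solve[OF gs] by blast
    have ub': "norm (u m) \<le> M * norm x" for m
      using order_trans[OF ub gM[unfolded \<rho>_def]] .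
    define k where "k m = state u m - opow Q m (x - P x)" for m
    have kb: "norm (k m) \<le> K * norm x" for m
    proof -
      have "norm (x - P x) \<le> norm x + norm P * norm x"
        using norm_triangle_ineq4[of x "P x"] norm_blinfun[of P x] by linarith
      then have "norm (opow Q m (x - P x)) \<le> q * ((1 + norm P) * norm x)"
        by (intro order_trans[OF norm_blinfun] mult_mono Qn order_trans[OF norm_ge_zero Qn])
          (auto simp: algebra_simps)
      moreover have "norm (state u m) \<le> (q + (\<Sum>n. norm (fwd n))) * (norm B * (M * norm x))"
        unfolding q_def by (rule state_bound[OF ub'])
      ultimately show ?thesis
        unfolding k_def K_def using norm_triangle_ineq4[of "state u m" "opow Q m (x - P x)"]
        by (simp add: algebra_simps)
    qed
    have "A' (k (Suc m)) = k m" for m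
    proof -
      \<comment> \<open>The choice of \<open>g\<close> turns the output into
        \<open>u m + D (u m)\<close>, so the feedback \<open>Ei\<close> returns exactly the input
        \<open>u m\<close>.\<close>
      have "C (k (Suc m)) = D (u m) - toep u m - C (opow Q (Suc m) x)"
        unfolding k_def blinfun.diff_right state_output[OF ub'] opow_Q_P by simp
      also have "\<dots> = (g m - toep u m) + D (u m)"
        by (simp add: g_def del: opow.simps)
      also have "g m - toep u m = u m" using u[of m] by (simp add: diff_eq_eq)
      finally have "Ei (C (k (Suc m))) = u m" by (simp add: Ei_left)
      moreover have "A (k (Suc m)) = k m + B (u m)"
        unfolding k_def blinfun.diff_right[of A] state_step[OF ub'] A_opow_Q
        by (simp add: blinfun.diff_right P_P)
      ultimately show ?thesis by (simp add: A'_eq)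
    qed
    then have "P' (k 0) = 0" using cl.backward_orbit_bounded[of k "K * norm x"] kb by blast
    \<comment> \<open>\<open>x + k 0\<close> equals \<open>state u 0 + P x\<close>, and both
      summands lie in the range of \<open>P\<close>.\<close>
    moreover have "P (x + k 0) = x + k 0"
      by (simp add: k_def blinfun.bilinear_simps P_state_0[OF ub'] P_P)
    ultimately show ?thesis
      using kb[of 0] by (intro exI[of _ "- k 0"]) (simp add: blinfun.minus_right)
  qed
  then show ?thesis using that by blast
qed

text \<open>The backward orbit of \<open>x\<close> under \<open>A'\<close> is an orbit of
  \<open>A\<close> driven by \<open>u\<close>. Its difference from \<open>state u\<close> is a
  bounded undriven orbit, hence in the kernel of \<open>P\<close>, and starts in the range of
  \<open>P\<close>; so it vanishes. Then \<open>u\<close> solves the homogeneous Toeplitz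
  equation.\<close>

lemma subspaces_inter:
  assumes x': "P' x = 0" and x: "P x = x"
  shows "x = 0"
proof -
  define q where "q = (\<Sum>n. norm (opow Q' n))"
  have Qn: "norm (opow Q' n) \<le> q" for n
    unfolding q_def using sum_le_suminf[OF cl.Q_summable, of "{n}"] by simp
  define k where "k m = opow Q' m x" for m
  define u where "u m = Ei (C (k (Suc m)))" for m
  have kb: "norm (k m) \<le> q * norm x" for m
    unfolding k_def by (rule order_trans[OF norm_blinfun mult_right_mono[OF Qn]]) simp
  have ule: "norm (u m) \<le> norm (Ei o\<^sub>L C) * norm x * norm (opow Q' (Suc m))" for m
  proof -
    have "norm (u m) \<le> norm (Ei o\<^sub>L C) * norm (k (Suc m))"
      unfolding u_def using norm_blinfun[of "Ei o\<^sub>L C" "k (Suc m)"] by simp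
    also have "\<dots> \<le> norm (Ei o\<^sub>L C) * (norm (opow Q' (Suc m)) * norm x)"
      unfolding k_def by (intro mult_left_mono norm_blinfun norm_ge_zero)
    finally show ?thesis by (simp only: ac_simps)
  qed
  define b where "b = norm (Ei o\<^sub>L C) * norm x * q"
  have ub: "norm (u m) \<le> b" for m
    unfolding b_def by (rule order_trans[OF ule mult_left_mono[OF Qn]]) simp
  have s: "summable (\<lambda>n. norm (opow Q' (Suc n)))" using cl.Q_summable by (subst summable_Suc_iff)
  have "summable (\<lambda>m. norm (u m))"
    by (rule summable_comparison_test[OF _ summable_mult[OF s, of "norm (Ei o\<^sub>L C) * norm x"]])
      (use ule in \<open>simp del: opow.simps\<close>)
  then have u2: "summable (\<lambda>m. (norm (u m))\<^sup>2)" by (rule summable_norm_square)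
  have kA: "A (k (Suc m)) = k m + B (u m)" for m
  proof -
    have "A' (k (Suc m)) = k m"
      unfolding k_def cl.A_opow_Q by (simp add: x')
    then show ?thesis by (simp add: A'_eq u_def algebra_simps)
  qed
  define \<delta> where "\<delta> m = k m - state u m" for m
  have step: "A (\<delta> (Suc m)) = \<delta> m" for m
    by (simp add: \<delta>_def blinfun.diff_right kA state_step[OF ub])
  define c where "c = q * norm x + ((\<Sum>n. norm (opow Q n)) + (\<Sum>n. norm (fwd n))) * (norm B * b)"
  have "norm (\<delta> m) \<le> c" for m
    unfolding \<delta>_def c_def using norm_triangle_ineq4[of "k m" "state u m"] kb[of m] state_bound[where v = u and m = m, OF ub] by linarith
  then have P\<delta>: "P (\<delta> m) = 0" for m
    using backward_orbit_bounded[of \<delta> c m] step by blast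
  have "\<delta> m = 0" for m
  proof (induction m)
    case 0
    have "P (\<delta> 0) = \<delta> 0" by (simp add: \<delta>_def blinfun.diff_right k_def x P_state_0[OF ub])
    then show ?case using P\<delta> by simp
  next
    case (Suc m)
    \<comment> \<open>On the kernel of \<open>P\<close> the operator \<open>Q\<close> inverts
      \<open>A\<close>, so vanishing passes from \<open>m\<close> to \<open>Suc m\<close>.\<close>
    have "\<delta> (Suc m) = Q (A (\<delta> (Suc m)))" by (simp add: Q_A P\<delta>)
    then show ?case by (simp add: step Suc blinfun.zero_right)
  qed
  then have ks: "k m = state u m" for m by (simp add: \<delta>_def)
  have "u m + toep u m = 0" for m
  proof -
    have "u m + D (u m) = C (k (Suc m))" unfolding u_def by (rule Ei_right)
    also have "\<dots> = D (u m) - toep u m" unfolding ks by (rule state_output[OF ub])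
    finally show ?thesis by (simp add: algebra_simps)
  qed
  then have "u m = 0" for m by (rule toep_injective[OF u2])
  then have "state u 0 = 0" by (simp add: state_def blinfun.zero_right)
  then show ?thesis using ks[of 0] by (simp add: k_def)
qed

end


section \<open>Projections and analytic extensions\<close>

lemma (in dichotomy_splitting) P_resolvent:
  assumes R: "op_invertible (id_blinfun - z *\<^sub>C A)"
  shows "P (op_inv (id_blinfun - z *\<^sub>C A) x) = op_inv (id_blinfun - z *\<^sub>C A) (P x)"
proof -
  let ?R = "op_inv (id_blinfun - z *\<^sub>C A)"
  have "?R x - z *\<^sub>C A (?R x) = x"
    using op_inv_apply(2)[OF R, of x] by (simp add: blinfun.bilinear_simps)
  from arg_cong[OF this, of "blinfun_apply P"]
  have "(id_blinfun - z *\<^sub>C A) (P (?R x)) = P x"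
    by (simp add: blinfun.bilinear_simps P_A P_C)
  then show ?thesis using op_inv_apply(1)[OF R] by metis
qed

text \<open>The points where the affine family is invertible form an open set on which its inverse
  is differentiable. Below, the family is \<open>I - z A P\<close> for the disc and
  \<open>z I - Q\<close> for its exterior.\<close>

lemma extends_analytically_affine:
  fixes X Y :: "'a::{complex_normed_vector, banach} \<Rightarrow>\<^sub>L 'a"
    and L :: "'a \<Rightarrow>\<^sub>L 'b::complex_normed_vector" and M :: "'c::complex_normed_vector \<Rightarrow>\<^sub>L 'a"
  assumes X: "X \<in> bounded_ops" and Y: "Y \<in> bounded_ops" and L: "L \<in> bounded_ops"
    and K: "\<And>z. z \<in> K \<Longrightarrow> op_invertible (X + z *\<^sub>C Y)"
    and eq: "\<And>z. z \<in> S \<Longrightarrow> op_invertible (X + z *\<^sub>C Y) \<Longrightarrow>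
      f z = F0 + z *\<^sub>C (L o\<^sub>L op_inv (X + z *\<^sub>C Y) o\<^sub>L M)"
  shows "extends_analytically f S K"
proof -
  define U where "U = {z. op_invertible (X + z *\<^sub>C Y)}"
  define H where "H z = L o\<^sub>L op_inv (X + z *\<^sub>C Y) o\<^sub>L M" for z
  have "open U"
    unfolding open_subopen[of U]
  proof
    fix z assume "z \<in> U"
    then have "eventually (\<lambda>w. w \<in> U) (nhds z)"
      using affine_inverse(1)[OF X Y] by (simp add: U_def)
    then show "\<exists>T. open T \<and> z \<in> T \<and> T \<subseteq> U" by (auto simp: eventually_nhds)
  qed
  moreover have "\<exists>d. ((\<lambda>w. F0 + w *\<^sub>C H w) has_derivative (\<lambda>h. h *\<^sub>C d)) (at z)" if "z \<in> U" for z
  proof -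
    define d where "d = - (op_inv (X + z *\<^sub>C Y) o\<^sub>L Y o\<^sub>L op_inv (X + z *\<^sub>C Y))"
    have bl: "bounded_linear (\<lambda>T. L o\<^sub>L T o\<^sub>L M)"
      by (intro bounded_linear_compose[OF bounded_bilinear.bounded_linear_left[OF bounded_bilinear_blinfun_compose]]
          bounded_bilinear.bounded_linear_right[OF bounded_bilinear_blinfun_compose])
    have "((\<lambda>w. op_inv (X + w *\<^sub>C Y)) has_derivative (\<lambda>h. h *\<^sub>C d)) (at z)"
      using affine_inverse(2)[OF X Y] that by (simp add: U_def d_def)
    from bounded_linear.has_derivative[OF bl this]
    have "(H has_derivative (\<lambda>h. L o\<^sub>L (h *\<^sub>C d) o\<^sub>L M)) (at z)"
      unfolding H_def[abs_def] .
    from bounded_bilinear.FDERIV[OF bounded_bilinear_scaleC has_derivative_ident this]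
    have "((\<lambda>w. w *\<^sub>C H w) has_derivative (\<lambda>h. z *\<^sub>C (L o\<^sub>L (h *\<^sub>C d) o\<^sub>L M) + h *\<^sub>C H z)) (at z)" .
    moreover have "z *\<^sub>C (L o\<^sub>L (h *\<^sub>C d) o\<^sub>L M) + h *\<^sub>C H z = h *\<^sub>C (z *\<^sub>C (L o\<^sub>L d o\<^sub>L M) + H z)" for h
      by (rule blinfun_eqI)
        (simp add: blinfun.bilinear_simps bounded_opsD[OF L] scaleC_scaleC scaleC_add_right mult.commute)
    ultimately have "((\<lambda>w. w *\<^sub>C H w) has_derivative (\<lambda>h. h *\<^sub>C (z *\<^sub>C (L o\<^sub>L d o\<^sub>L M) + H z))) (at z)"
      by simp
    from has_derivative_add[OF has_derivative_const[of F0] this] show ?thesis by auto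
  qed
  ultimately have "vec_analytic_on (\<lambda>w. F0 + w *\<^sub>C H w) U" by (simp add: vec_analytic_on_def)
  moreover have "K \<subseteq> U" using K by (auto simp: U_def)
  ultimately show ?thesis
    unfolding extends_analytically_def
    by (intro exI[of _ U] exI[of _ "\<lambda>w. F0 + w *\<^sub>C H w"]) (auto simp: U_def H_def eq)
qed

section \<open>Dichotomy of the closed-loop operator\<close>

text \<open>The unit circle is invariant under inversion, so both forms of the resolvent condition
  range over the same points.\<close>

lemma op_inv_circle:
  assumes "A \<in> bounded_ops"
  shows "dichotomous A \<longleftrightarrow> (\<forall>z. norm z = 1 \<longrightarrow> op_invertible (id_blinfun - z *\<^sub>C A))"
proof -
  have e: "op_invertible (id_blinfun - inverse z *\<^sub>C A) \<longleftrightarrow> op_invertible (z *\<^sub>C id_blinfun - A)"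
    if "norm z = 1" for z
  proof -
    have "z \<noteq> 0" using that by auto
    then show ?thesis using op_invertible_inverse_arg[OF assms, of "inverse z"] by simp
  qed
  have "dichotomous A \<longleftrightarrow> (\<forall>z. norm z = 1 \<longrightarrow> op_invertible (z *\<^sub>C id_blinfun - A))"
    by (auto simp: dichotomous_def op_spectrum_def)
  also have "\<dots> \<longleftrightarrow> (\<forall>z. norm z = 1 \<longrightarrow> op_invertible (id_blinfun - z *\<^sub>C A))"
  proof (intro iffI allI impI)
    fix z :: complex
    assume *: "\<forall>z. norm z = 1 \<longrightarrow> op_invertible (z *\<^sub>C id_blinfun - A)" and z: "norm z = 1"
    then show "op_invertible (id_blinfun - z *\<^sub>C A)"
      using e[of "inverse z"] by (simp add: norm_inverse)
  next
    fix z :: complex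
    assume *: "\<forall>z. norm z = 1 \<longrightarrow> op_invertible (id_blinfun - z *\<^sub>C A)" and z: "norm z = 1"
    then show "op_invertible (z *\<^sub>C id_blinfun - A)"
      using e[OF z] by (simp add: norm_inverse)
  qed
  finally show ?thesis .
qed

text \<open>Continuity on the compact circle supplies the boundedness that gives the supremum its
  meaning.\<close>

lemma transfer_function_le_sup_norm:
  fixes A :: "'x::complex_hilbert_space \<Rightarrow>\<^sub>L 'x"
    and B :: "'u::complex_normed_vector \<Rightarrow>\<^sub>L 'x" and C :: "'x \<Rightarrow>\<^sub>L 'v::complex_normed_vector"
  assumes A: "A \<in> bounded_ops" and inv: "\<And>z. norm z = 1 \<Longrightarrow> op_invertible (id_blinfun - z *\<^sub>C A)"
    and z: "norm z = 1"
  shows "norm (D + z *\<^sub>C (C o\<^sub>L op_inv (id_blinfun - z *\<^sub>C A) o\<^sub>L B))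
    \<le> sup_norm_circle (\<lambda>z. D + z *\<^sub>C (C o\<^sub>L op_inv (id_blinfun - z *\<^sub>C A) o\<^sub>L B))"
  unfolding sup_norm_circle_def
proof (rule cSUP_upper)
  have "isCont (\<lambda>w. op_inv (id_blinfun - w *\<^sub>C A)) w" if "norm w = 1" for w
    using affine_inverse(2)[of id_blinfun "- A" w] A inv[OF that]
    by (auto dest!: has_derivative_continuous)
  then have "continuous_on (sphere 0 1) (\<lambda>w. op_inv (id_blinfun - w *\<^sub>C A))"
    by (intro continuous_at_imp_continuous_on) auto
  then have "continuous_on (sphere 0 1) (\<lambda>z. norm (D + z *\<^sub>C (C o\<^sub>L op_inv (id_blinfun - z *\<^sub>C A) o\<^sub>L B)))"
    by (intro continuous_on_norm continuous_on_add continuous_on_const continuous_on_id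
        bounded_bilinear.continuous_on[OF bounded_bilinear_scaleC]
        bounded_bilinear.continuous_on[OF bounded_bilinear_blinfun_compose])
  then show "bdd_above ((\<lambda>z. norm (D + z *\<^sub>C (C o\<^sub>L op_inv (id_blinfun - z *\<^sub>C A) o\<^sub>L B))) ` sphere 0 1)"
    by (intro bounded_imp_bdd_above compact_imp_bounded compact_continuous_image) auto
qed (use z in simp)

text \<open>The Woodbury formula, with \<open>G z\<close> inverted by a Neumann series.\<close>

lemma closed_loop_invertible:
  fixes A :: "'x::complex_normed_vector \<Rightarrow>\<^sub>L 'x"
    and B :: "'u::{complex_normed_vector, banach} \<Rightarrow>\<^sub>L 'x" and C :: "'x \<Rightarrow>\<^sub>L 'u"
  assumes ops: "A \<in> bounded_ops" "B \<in> bounded_ops" "C \<in> bounded_ops" "D \<in> bounded_ops"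
    and E: "op_invertible (id_blinfun + D)"
    and R: "op_invertible (id_blinfun - z *\<^sub>C A)"
    and less: "norm (D + z *\<^sub>C (C o\<^sub>L op_inv (id_blinfun - z *\<^sub>C A) o\<^sub>L B)) < 1"
  shows "op_invertible (id_blinfun - z *\<^sub>C (A - (B o\<^sub>L op_inv (id_blinfun + D) o\<^sub>L C)))"
proof -
  define R where "R = op_inv (id_blinfun - z *\<^sub>C A)"
  define T where "T = D + z *\<^sub>C (C o\<^sub>L R o\<^sub>L B)"
  define Ei where "Ei = op_inv (id_blinfun + D)"
  define A' where "A' = A - (B o\<^sub>L Ei o\<^sub>L C)"
  have R_ops: "R \<in> bounded_ops" unfolding R_def by (rule op_inv_bounded_ops[OF R])
  have Ei_ops: "Ei \<in> bounded_ops" unfolding Ei_def by (rule op_inv_bounded_ops[OF E])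
  have T_ops: "T \<in> bounded_ops" using ops R_ops by (auto simp: T_def)
  have "norm (- T) < 1" using less by (simp only: T_def R_def norm_minus_cancel)
  then have "op_invertible (id_blinfun + T)"
    using neumann_small(1)[OF bounded_ops_uminus[OF T_ops]] by (simp only: diff_minus_eq_add)
  define Gi where "Gi = op_inv (id_blinfun + T)"
  note G = op_inv_apply[OF \<open>op_invertible (id_blinfun + T)\<close>, folded Gi_def]
  have T: "T u = D u + z *\<^sub>C C (R (B u))" for u
    by (simp add: T_def blinfun.add_left)
  note hom = bounded_opsD[OF ops(1)] bounded_opsD[OF ops(2)] bounded_opsD[OF ops(3)] bounded_opsD[OF R_ops]
    bounded_opsD[OF Ei_ops]
  have Gi1: "Gi (u + D u + z *\<^sub>C C (R (B u))) = u" and Gi2: "Gi y + D (Gi y) + z *\<^sub>C C (R (B (Gi y))) = y" for u y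
    using G(1)[of u] G(2)[of y] by (simp_all add: T blinfun.add_left add.assoc)
  have R1: "R (x - z *\<^sub>C A x) = x" and R2: "R x - z *\<^sub>C A (R x) = x" for x
    using op_inv_apply[OF R, of x] by (simp_all add: R_def[symmetric] blinfun.diff_left)
  have E1: "Ei (u + D u) = u" and E2: "Ei u + D (Ei u) = u" for u
    using op_inv_apply[OF E, of u] by (simp_all add: Ei_def[symmetric] blinfun.add_left)
  define S where "S = R - z *\<^sub>C (R o\<^sub>L B o\<^sub>L Gi o\<^sub>L C o\<^sub>L R)"
  have "is_op_inverse (id_blinfun - z *\<^sub>C A') S"
  proof (rule is_op_inverseI)
    show "id_blinfun - z *\<^sub>C A' \<in> bounded_ops" using ops Ei_ops by (auto simp: A'_def)
  next
    fix x
    \<comment> \<open>\<open>e\<close> is the feedback term. It solves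
      \<open>G(z) e = C R y\<close>, so \<open>Gi\<close> recovers it; hence the shape of
      \<open>S\<close>.\<close>
    define e where "e = Ei (C x)"
    define y where "y = (id_blinfun - z *\<^sub>C A') x"
    have y: "y = (x - z *\<^sub>C A x) + z *\<^sub>C B e"
      by (simp add: y_def A'_def e_def blinfun.bilinear_simps complex_vector.scale_right_diff_distrib)
    have Ry: "R y = x + z *\<^sub>C R (B e)" by (simp only: y blinfun.add_right R1 hom)
    have "C (R y) = e + D e + z *\<^sub>C C (R (B e))"
      by (simp add: Ry blinfun.add_right hom e_def E2)
    then have "Gi (C (R y)) = e" by (simp add: Gi1)
    then show "S ((id_blinfun - z *\<^sub>C A') x) = x"
      unfolding y_def[symmetric] by (simp add: S_def blinfun.diff_left Ry)
  next
    fix y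
    define v where "v = Gi (C (R y))"
    define w where "w = S y"
    have w: "w = R y - z *\<^sub>C R (B v)" by (simp add: w_def v_def S_def blinfun.diff_left)
    have "C w = v + D v"
      using Gi2[of "C (R y)"] by (simp add: w blinfun.diff_right hom v_def[symmetric] diff_eq_eq)
    then have "Ei (C w) = v" by (simp add: E1)
    moreover have "w - z *\<^sub>C A w = y - z *\<^sub>C B v"
    proof -
      have "w - z *\<^sub>C A w = (R y - z *\<^sub>C A (R y)) - z *\<^sub>C (R (B v) - z *\<^sub>C A (R (B v)))"
        by (simp add: w blinfun.diff_right hom complex_vector.scale_right_diff_distrib)
      then show ?thesis by (simp add: R2)
    qed
    ultimately show "(id_blinfun - z *\<^sub>C A') (S y) = y"
      unfolding w_def[symmetric]
      by (simp add: A'_def blinfun.add_left blinfun.diff_left blinfun.minus_left complex_vector.scale_right_diff_distrib algebra_simps)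
  qed
  then show ?thesis unfolding A'_def Ei_def by (rule op_invertibleI)
qed

section \<open>The oblique projection\<close>

text \<open>The trivial intersection makes the chosen component unique and therefore linear in
  \<open>x\<close>; the uniform estimate in \<open>span\<close> makes it bounded.\<close>

lemma projection_exists:
  fixes P P' :: "'a::complex_normed_vector \<Rightarrow>\<^sub>L 'a"
  assumes ops: "P \<in> bounded_ops" "P' \<in> bounded_ops" and PP: "\<And>x. P (P x) = P x"
    and inter: "\<And>x. P' x = 0 \<Longrightarrow> P x = x \<Longrightarrow> x = 0"
    and span: "\<And>x. \<exists>y. P' y = 0 \<and> P (x - y) = x - y \<and> norm y \<le> K * norm x"
  obtains Pl where "is_projection_along Pl {x. P' x = 0} (range P)"
proof -
  obtain p where p: "\<And>x. P' (p x) = 0" "\<And>x. P (x - p x) = x - p x" "\<And>x. norm (p x) \<le> K * norm x"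
    using span by metis
  have uniq: "p x = y" if "P' y = 0" "P (x - y) = x - y" for x y
  proof -
    have "p x - y = 0"
    proof (rule inter)
      show "P' (p x - y) = 0" using that p(1) by (simp add: blinfun.diff_right)
      have "P (p x - y) = P (x - y) - P (x - p x)" by (simp add: blinfun.diff_right)
      then show "P (p x - y) = p x - y" using that p(2) by simp
    qed
    then show ?thesis by simp
  qed
  have add: "p (x + y) = p x + p y" for x y
  proof (rule uniq)
    show "P' (p x + p y) = 0" using p(1) by (simp add: blinfun.add_right)
    have "P (x + y - (p x + p y)) = P (x - p x) + P (y - p y)"
      by (simp add: blinfun.bilinear_simps)
    then show "P (x + y - (p x + p y)) = x + y - (p x + p y)" by (simp add: p(2))
  qed
  have scale: "p (c *\<^sub>C x) = c *\<^sub>C p x" for c x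
  proof (rule uniq)
    show "P' (c *\<^sub>C p x) = 0" using p(1) by (simp add: bounded_opsD[OF ops(2)])
    show "P (c *\<^sub>C x - c *\<^sub>C p x) = c *\<^sub>C x - c *\<^sub>C p x"
      unfolding complex_vector.scale_right_diff_distrib[symmetric] bounded_opsD[OF ops(1)] p(2) ..
  qed
  have "p (r *\<^sub>R x) = r *\<^sub>R p x" for r x
    using scale[of "complex_of_real r" x] by (simp only: scaleC_of_real)
  moreover have "norm (p x) \<le> norm x * K" for x
    using p(3)[of x] by (simp only: mult.commute)
  ultimately have "bounded_linear p"
    by (intro bounded_linear_intro[of p K] add)
  then have ap: "blinfun_apply (Blinfun p) = p" by (rule bounded_linear_Blinfun_apply)
  have fixed: "p x = x" if "P' x = 0" for x by (rule uniq) (use that in \<open>auto simp: blinfun.zero_right\<close>)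
  have "is_projection_along (Blinfun p) {x. P' x = 0} (range P)"
    unfolding is_projection_along_def
  proof (intro conjI)
    show "Blinfun p \<in> bounded_ops" by (simp add: bounded_ops_def ap scale)
    show "Blinfun p o\<^sub>L Blinfun p = Blinfun p" by (rule blinfun_eqI) (simp add: ap fixed p(1))
    show "range (blinfun_apply (Blinfun p)) = {x. P' x = 0}"
      unfolding ap
    proof (intro equalityI subsetI)
      fix x assume "x \<in> {x. P' x = 0}"
      then have "x = p x" by (simp add: fixed)
      then show "x \<in> range p" by (rule range_eqI)
    qed (auto simp: p(1))
    have "p x = 0 \<longleftrightarrow> P x = x" for x
    proof
      show "P x = x" if "p x = 0" using p(2)[of x] by (simp only: that diff_zero)
      show "p x = 0" if "P x = x" by (rule uniq) (simp_all add: that blinfun.zero_right)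
    qed
    then have "{x. blinfun_apply (Blinfun p) x = 0} = {x. P x = x}"
      by (simp only: ap)
    also have "\<dots> = range P"
    proof (intro equalityI subsetI)
      fix x assume "x \<in> {x. P x = x}"
      then have "x = P x" by simp
      then show "x \<in> range P" by (rule range_eqI)
    qed (auto simp: PP)
    finally show "{x. blinfun_apply (Blinfun p) x = 0} = range P" .
  qed
  then show ?thesis using that by blast
qed

lemma projection_along_eq:
  assumes "is_projection_along Pl M N"
  shows "projection_along M N = Pl"
  unfolding projection_along_def
proof (rule the_equality[where P = "\<lambda>P. is_projection_along P M N", OF assms])
  fix Pl' assume *: "is_projection_along Pl' M N"
  have idem: "T (T x) = T x" if "is_projection_along T M N" for T :: "'a \<Rightarrow>\<^sub>L 'a" and x
    using that unfolding is_projection_along_def by (metis blinfun_apply_blinfun_compose)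
  show "Pl' = Pl"
  proof (rule blinfun_eqI)
    fix x
    have "Pl x \<in> M" using assms by (auto simp: is_projection_along_def)
    then obtain w where "Pl x = Pl' w" using * by (auto simp: is_projection_along_def)
    then have 1: "Pl' (Pl x) = Pl x" using idem[OF *] by simp
    have "Pl (x - Pl x) = 0" using idem[OF assms] by (simp add: blinfun.diff_right)
    then have "x - Pl x \<in> N" using assms by (auto simp: is_projection_along_def)
    then have "Pl' (x - Pl x) = 0" using * by (auto simp: is_projection_along_def)
    then show "Pl' x = Pl x" using 1 by (simp add: blinfun.diff_right)
  qed
qed

lemma is_projection_along_direct_sum:
  assumes "is_projection_along Pl M N"
  shows "direct_sum_decomp M N"
proof -
  have ops: "Pl \<in> bounded_ops" and N: "N = {x. Pl x = 0}" and range: "M = range Pl"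
    using assms by (auto simp: is_projection_along_def)
  have idem: "Pl (Pl x) = Pl x" for x
    using assms unfolding is_projection_along_def by (metis blinfun_apply_blinfun_compose)
  have M: "M = {x. Pl x = x}"
  proof (intro equalityI subsetI)
    fix x assume "x \<in> {x. Pl x = x}"
    then have "x = Pl x" by simp
    then show "x \<in> M" unfolding range by (rule range_eqI)
  qed (auto simp: range idem)
  have cont: "continuous_on UNIV (blinfun_apply Pl)"
    by (rule linear_continuous_on[OF blinfun.bounded_linear_right])
  show ?thesis
    unfolding direct_sum_decomp_def
  proof (intro conjI allI)
    show "complex_vector.subspace M" "complex_vector.subspace N"
      unfolding M N complex_vector.subspace_def
      by (auto simp: blinfun.bilinear_simps bounded_opsD[OF ops])
    show "closed M" unfolding M by (intro closed_Collect_eq cont continuous_on_id)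
    show "closed N" unfolding N by (intro closed_Collect_eq cont continuous_on_const)
    show "M \<inter> N = {0}" unfolding M N by (auto simp: blinfun.zero_right)
    show "\<exists>m\<in>M. \<exists>n\<in>N. x = m + n" for x
      by (intro bexI[of _ "Pl x"] bexI[of _ "x - Pl x"]) (auto simp: M N idem blinfun.diff_right)
  qed
qed


section \<open>The factorization\<close>

text \<open>\<open>Pl\<close> is the projection onto \<open>X\<^sub>-\<^sup>\<times>\<close> along \<open>X\<^sub>+\<close>.\<close>

locale factorization = closed_loop A P Q A' P' Q' B C D r Ei
  for A P Q A' P' Q' :: "'x::complex_hilbert_space \<Rightarrow>\<^sub>L 'x"
    and B :: "'u::complex_hilbert_space \<Rightarrow>\<^sub>L 'x" and C D r Ei +
  fixes Pl :: "'x \<Rightarrow>\<^sub>L 'x" and D1 D2 D1i D2i :: "'u \<Rightarrow>\<^sub>L 'u"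
  assumes Pi_ops: "Pl \<in> bounded_ops" and D1_ops: "D1 \<in> bounded_ops" and D2_ops: "D2 \<in> bounded_ops"
    and D1: "is_op_inverse D1 D1i" and D2: "is_op_inverse D2 D2i"
    and D12: "\<And>u. D1 (D2 u) = u + D u"
    and P'_Pi: "\<And>x. P' (Pl x) = 0" and P_comp: "\<And>x. P (x - Pl x) = x - Pl x"
    and Pi_fixed: "\<And>x. P' x = 0 \<Longrightarrow> Pl x = x" and Pi_zero: "\<And>x. P x = x \<Longrightarrow> Pl x = 0"
begin

definition Wp where "Wp z = D1 + z *\<^sub>C
  (C o\<^sub>L op_inv (id_blinfun - z *\<^sub>C A) o\<^sub>L (id_blinfun - Pl) o\<^sub>L B o\<^sub>L D2i)"
definition Wm where "Wm z = D2 + z *\<^sub>C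
  (D1i o\<^sub>L C o\<^sub>L Pl o\<^sub>L op_inv (id_blinfun - z *\<^sub>C A) o\<^sub>L B)"
definition Wp_inv where "Wp_inv z = D1i - z *\<^sub>C
  (D1i o\<^sub>L C o\<^sub>L (id_blinfun - Pl) o\<^sub>L op_inv (id_blinfun - z *\<^sub>C A') o\<^sub>L B o\<^sub>L D2i o\<^sub>L D1i)"
definition Wm_inv where "Wm_inv z = D2i - z *\<^sub>C
  (D2i o\<^sub>L D1i o\<^sub>L C o\<^sub>L op_inv (id_blinfun - z *\<^sub>C A') o\<^sub>L Pl o\<^sub>L B o\<^sub>L D2i)"

abbreviation N where "N x \<equiv> x - Pl x"

lemma inv_ops: "D1i \<in> bounded_ops" "D2i \<in> bounded_ops"
  using D1 D2 by (simp_all add: is_op_inverse_def)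

lemmas homs = bounded_opsD[OF B_ops] bounded_opsD[OF C_ops] bounded_opsD[OF D_ops] bounded_opsD[OF Pi_ops]
  bounded_opsD[OF D1_ops] bounded_opsD[OF D2_ops] bounded_opsD[OF inv_ops(1)] bounded_opsD[OF inv_ops(2)]
  A_C cl.A_C

lemmas D1_inv = is_op_inverse_apply[OF D1] and D2_inv = is_op_inverse_apply[OF D2]

lemma D2i_D1i: "D2i (D1i y) = Ei y"
  using D12[of "Ei y"] Ei_right[of y] by (metis D1_inv(1) D2_inv(1))

lemma D2_Ei: "D2 (Ei y) = D1i y"
  by (simp add: D2i_D1i[symmetric] D2_inv)

lemma B_Ei_C: "B (Ei (C x)) = A x - A' x"
  by (simp add: A'_eq)

text \<open>Invariance of the range of \<open>P\<close> under \<open>A\<close>, in the form used in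
  computations.\<close>

lemma Pi_A_N: "Pl (A (N x)) = 0"
  by (rule Pi_zero) (simp only: P_A P_comp)

text \<open>Invariance of the kernel of \<open>P'\<close> under \<open>A'\<close>.\<close>

lemma Pi_A'_Pi: "Pl (A' (Pl x)) = A' (Pl x)"
  by (rule Pi_fixed) (simp add: cl.P_A P'_Pi blinfun.zero_right)

lemma resolvent_apply:
  assumes "op_invertible (id_blinfun - z *\<^sub>C T)"
  shows "op_inv (id_blinfun - z *\<^sub>C T) y - z *\<^sub>C T (op_inv (id_blinfun - z *\<^sub>C T) y) = y"
    and "x - z *\<^sub>C T x = y \<Longrightarrow> op_inv (id_blinfun - z *\<^sub>C T) y = x"
proof -
  show "op_inv (id_blinfun - z *\<^sub>C T) y - z *\<^sub>C T (op_inv (id_blinfun - z *\<^sub>C T) y) = y"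
    using op_inv_apply(2)[OF assms, of y] by (simp add: blinfun.diff_left)
  show "op_inv (id_blinfun - z *\<^sub>C T) y = x" if "x - z *\<^sub>C T x = y"
    using op_inv_apply(1)[OF assms, of x] that by (simp add: blinfun.diff_left)
qed

lemma Wp_apply: "Wp z u = D1 u + z *\<^sub>C C (op_inv (id_blinfun - z *\<^sub>C A) (N (B (D2i u))))"
  and Wm_apply: "Wm z u = D2 u + z *\<^sub>C D1i (C (Pl (op_inv (id_blinfun - z *\<^sub>C A) (B u))))"
  and Wp_inv_apply: "Wp_inv z u = D1i u - z *\<^sub>C D1i (C (N (op_inv (id_blinfun - z *\<^sub>C A') (B (Ei u)))))"
  and Wm_inv_apply: "Wm_inv z u = D2i u - z *\<^sub>C Ei (C (op_inv (id_blinfun - z *\<^sub>C A') (Pl (B (D2i u)))))"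
  by (simp_all add: Wp_def Wm_def Wp_inv_def Wm_inv_def blinfun.add_left blinfun.diff_left D2i_D1i)

text \<open>If \<open>s\<close> is the state of \<open>G\<close> for the input \<open>u\<close>,
  then \<open>Wm\<close> reads off \<open>Pl s\<close>, and feeding its output to \<open>Wp\<close>
  produces exactly the state \<open>N s\<close>. The two contributions add up to
  \<open>C s\<close>.\<close>

lemma Wp_Wm:
  assumes R: "op_invertible (id_blinfun - z *\<^sub>C A)"
  shows "id_blinfun + (D + z *\<^sub>C (C o\<^sub>L op_inv (id_blinfun - z *\<^sub>C A) o\<^sub>L B)) = Wp z o\<^sub>L Wm z"
proof (rule blinfun_eqI)
  fix u
  define s where "s = op_inv (id_blinfun - z *\<^sub>C A) (B u)"
  define w where "w = Wm z u"
  have s: "s - z *\<^sub>C A s = B u" unfolding s_def by (rule resolvent_apply(1)[OF R])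
  have w: "w = D2 u + z *\<^sub>C D1i (C (Pl s))" by (simp add: w_def Wm_apply s_def)
  have "B (D2i w) = B u + z *\<^sub>C (A (Pl s) - A' (Pl s))"
    by (simp add: w blinfun.add_right homs D2_inv D2i_D1i B_Ei_C)
  also have "B u = s - z *\<^sub>C A s" by (rule s[symmetric])
  finally have "B (D2i w) = s - z *\<^sub>C A (N s) - z *\<^sub>C A' (Pl s)"
    by (simp add: blinfun.diff_right complex_vector.scale_right_diff_distrib)
  then have "N (B (D2i w)) = N s - z *\<^sub>C A (N s)"
    by (simp add: blinfun.diff_right[of Pl] homs Pi_A_N Pi_A'_Pi complex_vector.scale_zero_right)
  then have "op_inv (id_blinfun - z *\<^sub>C A) (N (B (D2i w))) = N s"
    by (intro resolvent_apply(2)[OF R]) simp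
  then have "Wp z w = D1 w + z *\<^sub>C C (N s)" by (simp only: Wp_apply)
  also have "D1 w = D1 (D2 u) + z *\<^sub>C C (Pl s)" by (simp add: w blinfun.add_right homs D1_inv)
  also have "D1 (D2 u) + z *\<^sub>C C (Pl s) + z *\<^sub>C C (N s) = u + D u + z *\<^sub>C C s"
    by (simp add: D12 blinfun.diff_right complex_vector.scale_right_diff_distrib)
  finally show "(id_blinfun + (D + z *\<^sub>C (C o\<^sub>L op_inv (id_blinfun - z *\<^sub>C A) o\<^sub>L B))) u = (Wp z o\<^sub>L Wm z) u"
    by (simp add: w_def s_def blinfun.add_left add.assoc)
qed

lemma Pi_resolvent_range_P:
  assumes R: "op_invertible (id_blinfun - z *\<^sub>C A)" and x: "P x = x"
  shows "Pl (op_inv (id_blinfun - z *\<^sub>C A) x) = 0"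
  by (rule Pi_zero) (simp add: P_resolvent[OF R] x)

lemma Pi_resolvent_ker_P':
  assumes R: "op_invertible (id_blinfun - z *\<^sub>C A')" and x: "P' x = 0"
  shows "Pl (op_inv (id_blinfun - z *\<^sub>C A') x) = op_inv (id_blinfun - z *\<^sub>C A') x"
  by (rule Pi_fixed) (simp add: cl.P_resolvent[OF R] x blinfun.zero_right)

text \<open>In either order the state of \<open>Wp\<close> is \<open>N s\<close>, with
  \<open>s\<close> the state of \<open>Wp_inv\<close>, so the output terms cancel. In the second
  order this holds because \<open>s - t\<close> lies in the kernel of \<open>P'\<close> and
  \<open>t\<close> in the range of \<open>P\<close>.\<close>

lemma Wp_inverse:
  assumes R: "op_invertible (id_blinfun - z *\<^sub>C A)" and R': "op_invertible (id_blinfun - z *\<^sub>C A')"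
  shows "is_op_inverse (Wp z) (Wp_inv z)"
proof (rule is_op_inverseI)
  let ?R = "op_inv (id_blinfun - z *\<^sub>C A)" and ?R' = "op_inv (id_blinfun - z *\<^sub>C A')"
  show "Wp z \<in> bounded_ops"
    unfolding Wp_def using B_ops C_ops Pi_ops D1_ops inv_ops op_inv_bounded_ops[OF R] by auto
  show "Wp z (Wp_inv z y) = y" for y
  proof -
    define s where "s = ?R' (B (Ei y))"
    define x where "x = Wp_inv z y"
    have s: "s - z *\<^sub>C A' s = B (Ei y)" unfolding s_def by (rule resolvent_apply(1)[OF R'])
    have x: "x = D1i y - z *\<^sub>C D1i (C (N s))" by (simp add: x_def Wp_inv_apply s_def)
    have "B (D2i x) = B (Ei y) - z *\<^sub>C (A (N s) - A' (N s))"
      by (simp only: x blinfun.diff_right[of D2i] blinfun.diff_right[of B] homs D2i_D1i B_Ei_C)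
    also have "B (Ei y) = s - z *\<^sub>C A' s" by (rule s[symmetric])
    finally have "B (D2i x) = s - z *\<^sub>C A (N s) - z *\<^sub>C A' (Pl s)"
      by (simp add: blinfun.diff_right complex_vector.scale_right_diff_distrib)
    then have "N (B (D2i x)) = N s - z *\<^sub>C A (N s)"
      by (simp add: blinfun.diff_right[of Pl] homs Pi_A_N Pi_A'_Pi complex_vector.scale_zero_right)
    then have "?R (N (B (D2i x))) = N s" by (intro resolvent_apply(2)[OF R]) simp
    then show ?thesis
      unfolding x_def[symmetric] by (simp add: Wp_apply) (simp add: x blinfun.diff_right[of D1] homs D1_inv)
  qed
  show "Wp_inv z (Wp z u) = u" for u
  proof -
    define t where "t = ?R (N (B (D2i u)))"
    define y where "y = Wp z u"
    define s where "s = ?R' (B (Ei y))"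
    have t: "t - z *\<^sub>C A t = N (B (D2i u))" unfolding t_def by (rule resolvent_apply(1)[OF R])
    have Pit: "Pl t = 0" unfolding t_def by (rule Pi_resolvent_range_P[OF R P_comp])
    have y: "y = D1 u + z *\<^sub>C C t" by (simp add: y_def Wp_apply t_def)
    have "B (Ei y) = B (D2i u) + z *\<^sub>C (A t - A' t)"
      unfolding D2i_D1i[symmetric] y by (simp add: blinfun.add_right homs D1_inv D2i_D1i B_Ei_C)
    moreover have s: "s - z *\<^sub>C A' s = B (Ei y)" unfolding s_def by (rule resolvent_apply(1)[OF R'])
    ultimately have s': "s - z *\<^sub>C A' s = B (D2i u) + z *\<^sub>C (A t - A' t)" by simp
    have "(s - t) - z *\<^sub>C A' (s - t) = (s - z *\<^sub>C A' s) - (t - z *\<^sub>C A t) - z *\<^sub>C (A t - A' t)"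
      by (simp add: blinfun.diff_right complex_vector.scale_right_diff_distrib)
    also have "\<dots> = Pl (B (D2i u))" unfolding s' t by simp
    finally have "?R' (Pl (B (D2i u))) = s - t" by (rule resolvent_apply(2)[OF R'])
    then have "Pl (s - t) = s - t" using Pi_resolvent_ker_P'[OF R' P'_Pi] by metis
    then have "N s = t" by (simp add: blinfun.diff_right Pit)
    then show ?thesis
      unfolding y_def[symmetric]
      by (simp add: Wp_inv_apply s_def[symmetric]) (simp add: y blinfun.add_right homs D1_inv)
  qed
qed

text \<open>Here the state of \<open>Wm_inv\<close> is \<open>Pl t\<close>, with \<open>t\<close>
  the state of \<open>Wm\<close>. In the first order \<open>t - s\<close> stays in the range of
  \<open>P\<close>, which \<open>Pl\<close> annihilates.\<close>

lemma Wm_inverse: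
  assumes R: "op_invertible (id_blinfun - z *\<^sub>C A)" and R': "op_invertible (id_blinfun - z *\<^sub>C A')"
  shows "is_op_inverse (Wm z) (Wm_inv z)"
proof (rule is_op_inverseI)
  let ?R = "op_inv (id_blinfun - z *\<^sub>C A)" and ?R' = "op_inv (id_blinfun - z *\<^sub>C A')"
  have Ei_C: "Ei (c *\<^sub>C y) = c *\<^sub>C Ei y" for c y by (simp add: D2i_D1i[symmetric] homs)
  show "Wm z \<in> bounded_ops"
    unfolding Wm_def using B_ops C_ops Pi_ops D2_ops inv_ops op_inv_bounded_ops[OF R] by auto
  show "Wm z (Wm_inv z y) = y" for y
  proof -
    define s where "s = ?R' (Pl (B (D2i y)))"
    define x where "x = Wm_inv z y"
    define t where "t = ?R (B x)"
    have s: "s - z *\<^sub>C A' s = Pl (B (D2i y))" unfolding s_def by (rule resolvent_apply(1)[OF R'])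
    have t: "t - z *\<^sub>C A t = B x" unfolding t_def by (rule resolvent_apply(1)[OF R])
    have Pis: "Pl s = s" unfolding s_def by (rule Pi_resolvent_ker_P'[OF R' P'_Pi])
    have x: "x = D2i y - z *\<^sub>C Ei (C s)" by (simp add: x_def Wm_inv_apply s_def)
    have "B x = B (D2i y) - z *\<^sub>C (A s - A' s)"
      by (simp only: x blinfun.diff_right[of B] homs B_Ei_C)
    then have "(t - s) - z *\<^sub>C A (t - s) = N (B (D2i y))"
      unfolding t[symmetric] s[symmetric]
      by (simp add: blinfun.diff_right complex_vector.scale_right_diff_distrib algebra_simps)
    then have "?R (N (B (D2i y))) = t - s" by (rule resolvent_apply(2)[OF R])
    then have "Pl (t - s) = 0" using Pi_resolvent_range_P[OF R P_comp] by metis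
    then have "Pl t = s" by (simp add: blinfun.diff_right Pis)
    then show ?thesis
      unfolding x_def[symmetric]
      by (simp add: Wm_apply t_def[symmetric]) (simp add: x blinfun.diff_right homs D2_inv D2_Ei)
  qed
  show "Wm_inv z (Wm z u) = u" for u
  proof -
    define t where "t = ?R (B u)"
    define y where "y = Wm z u"
    have t: "t - z *\<^sub>C A t = B u" unfolding t_def by (rule resolvent_apply(1)[OF R])
    have y: "y = D2 u + z *\<^sub>C D1i (C (Pl t))" by (simp add: y_def Wm_apply t_def)
    have D2iy: "D2i y = u + z *\<^sub>C Ei (C (Pl t))"
      by (simp add: y blinfun.add_right homs D2_inv D2i_D1i)
    then have "B (D2i y) = B u + z *\<^sub>C (A (Pl t) - A' (Pl t))"
      by (simp only: blinfun.add_right homs B_Ei_C)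
    also have "B u = t - z *\<^sub>C A t" by (rule t[symmetric])
    finally have "B (D2i y) = t - z *\<^sub>C A (N t) - z *\<^sub>C A' (Pl t)"
      by (simp add: blinfun.diff_right complex_vector.scale_right_diff_distrib)
    then have "Pl (B (D2i y)) = Pl t - z *\<^sub>C A' (Pl t)"
      by (simp add: blinfun.diff_right[of Pl] homs Pi_A_N Pi_A'_Pi complex_vector.scale_zero_right)
    then have "?R' (Pl (B (D2i y))) = Pl t" by (intro resolvent_apply(2)[OF R']) simp
    then show ?thesis
      unfolding y_def[symmetric] by (simp add: Wm_inv_apply) (simp add: D2iy)
  qed
qed

section \<open>Analytic extension of the factors and their inverses\<close>

lemma affine_form:
  "id_blinfun + z *\<^sub>C (- T) = id_blinfun - z *\<^sub>C T" "- T + z *\<^sub>C id_blinfun = z *\<^sub>C id_blinfun - T"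
  by simp_all

text \<open>The resolvent acts only on the range of \<open>P\<close>, so \<open>A\<close> may be
  replaced by \<open>A o\<^sub>L P\<close>.\<close>

lemma Wp_extends: "extends_analytically Wp (inv_resolvent_set A) (cball 0 1)"
proof (rule extends_analytically_affine[where X = id_blinfun and Y = "- (A o\<^sub>L P)" and L = C
      and ?F0.0 = D1 and M = "P o\<^sub>L (id_blinfun - Pl) o\<^sub>L B o\<^sub>L D2i"], unfold affine_form)
  fix z assume z: "z \<in> inv_resolvent_set A" and U: "op_invertible (id_blinfun - z *\<^sub>C (A o\<^sub>L P))"
  have R: "op_invertible (id_blinfun - z *\<^sub>C A)" using z by (simp add: inv_resolvent_set_def)
  show "Wp z = D1 + z *\<^sub>C (C o\<^sub>L op_inv (id_blinfun - z *\<^sub>C (A o\<^sub>L P)) o\<^sub>L (P o\<^sub>L (id_blinfun - Pl) o\<^sub>L B o\<^sub>L D2i))"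
  proof (rule blinfun_eqI)
    fix u
    have "op_inv (id_blinfun - z *\<^sub>C A) (N (B (D2i u))) = op_inv (id_blinfun - z *\<^sub>C (A o\<^sub>L P)) (P (N (B (D2i u))))"
      using resolvent_stable_part[OF R U, of "N (B (D2i u))"] by (simp only: P_comp)
    then show "Wp z u = (D1 + z *\<^sub>C (C o\<^sub>L op_inv (id_blinfun - z *\<^sub>C (A o\<^sub>L P)) o\<^sub>L
        (P o\<^sub>L (id_blinfun - Pl) o\<^sub>L B o\<^sub>L D2i))) u"
      by (simp add: Wp_apply blinfun.add_left blinfun.diff_left)
  qed
qed (use A_ops P_ops C_ops in \<open>auto intro: invertible_stable_part\<close>)

text \<open>The resolvent of \<open>A'\<close> preserves the kernel of \<open>P'\<close>, which
  \<open>I - Pl\<close> annihilates; only the stable part remains.\<close>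

lemma Wp_inv_extends: "extends_analytically Wp_inv (inv_resolvent_set A') (cball 0 1)"
proof (rule extends_analytically_affine[where X = id_blinfun and Y = "- (A' o\<^sub>L P')"
      and L = "- (D1i o\<^sub>L C o\<^sub>L (id_blinfun - Pl))"
      and ?F0.0 = D1i and M = "P' o\<^sub>L B o\<^sub>L D2i o\<^sub>L D1i"], unfold affine_form)
  fix z assume z: "z \<in> inv_resolvent_set A'" and U: "op_invertible (id_blinfun - z *\<^sub>C (A' o\<^sub>L P'))"
  have R: "op_invertible (id_blinfun - z *\<^sub>C A')" using z by (simp add: inv_resolvent_set_def)
  show "Wp_inv z = D1i + z *\<^sub>C (- (D1i o\<^sub>L C o\<^sub>L (id_blinfun - Pl)) o\<^sub>L
      op_inv (id_blinfun - z *\<^sub>C (A' o\<^sub>L P')) o\<^sub>L (P' o\<^sub>L B o\<^sub>L D2i o\<^sub>L D1i))"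
  proof (rule blinfun_eqI)
    fix u
    let ?R = "op_inv (id_blinfun - z *\<^sub>C A')"
    define b where "b = B (Ei u)"
    have "?R b = ?R (P' b) + ?R (b - P' b)" by (simp add: blinfun.diff_right)
    moreover have "Pl (?R (b - P' b)) = ?R (b - P' b)"
      by (rule Pi_resolvent_ker_P'[OF R]) (simp add: blinfun.diff_right cl.P_P)
    ultimately have "N (?R b) = N (?R (P' b))" by (simp add: blinfun.add_right)
    also have "?R (P' b) = op_inv (id_blinfun - z *\<^sub>C (A' o\<^sub>L P')) (P' b)"
      by (rule cl.resolvent_stable_part[OF R U])
    finally show "Wp_inv z u = (D1i + z *\<^sub>C (- (D1i o\<^sub>L C o\<^sub>L (id_blinfun - Pl)) o\<^sub>L
      op_inv (id_blinfun - z *\<^sub>C (A' o\<^sub>L P')) o\<^sub>L (P' o\<^sub>L B o\<^sub>L D2i o\<^sub>L D1i))) u"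
      by (simp add: Wp_inv_apply blinfun.add_left blinfun.minus_left blinfun.diff_left D2i_D1i b_def
          complex_vector.scale_minus_right)
  qed
qed (use cl.A_ops cl.P_ops C_ops Pi_ops inv_ops in \<open>auto intro: cl.invertible_stable_part\<close>)

text \<open>The projection \<open>Pl\<close> annihilates the resolvent on the range of
  \<open>P\<close>, which leaves the part expressed by \<open>Q\<close>.\<close>

lemma Wm_extends: "extends_analytically Wm (inv_resolvent_set A) (- ball 0 1)"
proof (rule extends_analytically_affine[where X = "- Q" and Y = id_blinfun
      and L = "- (D1i o\<^sub>L C o\<^sub>L Pl o\<^sub>L Q)" and ?F0.0 = D2 and M = B], unfold affine_form)
  fix z assume z: "z \<in> inv_resolvent_set A" and V: "op_invertible (z *\<^sub>C id_blinfun - Q)"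
  have R: "op_invertible (id_blinfun - z *\<^sub>C A)" using z by (simp add: inv_resolvent_set_def)
  show "Wm z = D2 + z *\<^sub>C (- (D1i o\<^sub>L C o\<^sub>L Pl o\<^sub>L Q) o\<^sub>L op_inv (z *\<^sub>C id_blinfun - Q) o\<^sub>L B)"
  proof (rule blinfun_eqI)
    fix u
    let ?R = "op_inv (id_blinfun - z *\<^sub>C A)"
    define b where "b = B u"
    have "?R b = ?R (P b) + ?R (b - P b)" by (simp add: blinfun.diff_right)
    moreover have "Pl (?R (P b)) = 0" by (rule Pi_resolvent_range_P[OF R P_P])
    ultimately have "Pl (?R b) = Pl (?R (b - P b))" by (simp add: blinfun.add_right)
    also have "?R (b - P b) = - Q (op_inv (z *\<^sub>C id_blinfun - Q) b)"
      by (rule resolvent_antistable_part[OF R V])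
    finally show "Wm z u = (D2 + z *\<^sub>C (- (D1i o\<^sub>L C o\<^sub>L Pl o\<^sub>L Q) o\<^sub>L op_inv (z *\<^sub>C id_blinfun - Q) o\<^sub>L B)) u"
      by (simp add: Wm_apply blinfun.add_left blinfun.minus_left blinfun.minus_right b_def
          complex_vector.scale_minus_right)
  qed
qed (use Q_ops C_ops Pi_ops inv_ops in \<open>auto intro: invertible_antistable_part\<close>)

text \<open>The input \<open>Pl (B (D2i u))\<close> lies in the kernel of \<open>P'\<close>, so only
  \<open>Q'\<close> enters; its minus sign cancels the one in \<open>Wm_inv\<close>.\<close>

lemma Wm_inv_extends: "extends_analytically Wm_inv (inv_resolvent_set A') (- ball 0 1)"
proof (rule extends_analytically_affine[where X = "- Q'" and Y = id_blinfun
      and L = "D2i o\<^sub>L D1i o\<^sub>L C o\<^sub>L Q'" and ?F0.0 = D2i and M = "Pl o\<^sub>L B o\<^sub>L D2i"], unfold affine_form)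
  fix z assume z: "z \<in> inv_resolvent_set A'" and V: "op_invertible (z *\<^sub>C id_blinfun - Q')"
  have R: "op_invertible (id_blinfun - z *\<^sub>C A')" using z by (simp add: inv_resolvent_set_def)
  show "Wm_inv z = D2i + z *\<^sub>C (D2i o\<^sub>L D1i o\<^sub>L C o\<^sub>L Q' o\<^sub>L op_inv (z *\<^sub>C id_blinfun - Q') o\<^sub>L (Pl o\<^sub>L B o\<^sub>L D2i))"
  proof (rule blinfun_eqI)
    fix u
    define b where "b = Pl (B (D2i u))"
    have "op_inv (id_blinfun - z *\<^sub>C A') b = - Q' (op_inv (z *\<^sub>C id_blinfun - Q') b)"
      using cl.resolvent_antistable_part[OF R V, of b] by (simp add: b_def P'_Pi)
    then show "Wm_inv z u = (D2i + z *\<^sub>C (D2i o\<^sub>L D1i o\<^sub>L C o\<^sub>L Q' o\<^sub>L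
        op_inv (z *\<^sub>C id_blinfun - Q') o\<^sub>L (Pl o\<^sub>L B o\<^sub>L D2i))) u"
      by (simp add: Wm_inv_apply blinfun.add_left blinfun.minus_right b_def D2i_D1i[symmetric]
          complex_vector.scale_minus_right)
  qed
qed (use cl.Q_ops C_ops inv_ops in \<open>auto intro: cl.invertible_antistable_part\<close>)

end

theorem theorem3p2:
  fixes A A' P :: "'x::complex_hilbert_space \<Rightarrow>\<^sub>L 'x"
    and B :: "'u::complex_hilbert_space \<Rightarrow>\<^sub>L 'x"
    and C :: "'x \<Rightarrow>\<^sub>L 'u"
    and D D1 D2 :: "'u \<Rightarrow>\<^sub>L 'u"
    and F G Wp Wm Wp_inv Wm_inv :: "complex \<Rightarrow> 'u \<Rightarrow>\<^sub>L 'u"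
  assumes ops: "A \<in> bounded_ops" "B \<in> bounded_ops" "C \<in> bounded_ops" "D \<in> bounded_ops"
    and F: "F = (\<lambda>z. D + z *\<^sub>C (C o\<^sub>L op_inv (id_blinfun - z *\<^sub>C A) o\<^sub>L B))"
    and G: "G = (\<lambda>z. id_blinfun + F z)"
    and F_less: "sup_norm_circle F < 1"
    and dich: "dichotomous A"
    and inv_ID: "op_invertible (id_blinfun + D)"
    and factors: "D1 \<in> bounded_ops" "D2 \<in> bounded_ops" "op_invertible D1" "op_invertible D2"
      "id_blinfun + D = D1 o\<^sub>L D2"
    and A': "A' = A - (B o\<^sub>L op_inv (id_blinfun + D) o\<^sub>L C)"
    and P: "P = projection_along (X_minus A') (X_plus A)"
    and Wp: "Wp = (\<lambda>z. D1 +
      z *\<^sub>C (C o\<^sub>L op_inv (id_blinfun - z *\<^sub>C A) o\<^sub>L (id_blinfun - P) o\<^sub>L B o\<^sub>L op_inv D2))"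
    and Wm: "Wm = (\<lambda>z. D2 +
      z *\<^sub>C (op_inv D1 o\<^sub>L C o\<^sub>L P o\<^sub>L op_inv (id_blinfun - z *\<^sub>C A) o\<^sub>L B))"
    and Wp_inv: "Wp_inv = (\<lambda>z. op_inv D1 -
      z *\<^sub>C (op_inv D1 o\<^sub>L C o\<^sub>L (id_blinfun - P) o\<^sub>L op_inv (id_blinfun - z *\<^sub>C A') o\<^sub>L B
        o\<^sub>L op_inv D2 o\<^sub>L op_inv D1))"
    and Wm_inv: "Wm_inv = (\<lambda>z. op_inv D2 -
      z *\<^sub>C (op_inv D2 o\<^sub>L op_inv D1 o\<^sub>L C o\<^sub>L op_inv (id_blinfun - z *\<^sub>C A') o\<^sub>L P o\<^sub>L B
        o\<^sub>L op_inv D2))"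
  shows "dichotomous A' \<and>
    direct_sum_decomp (X_minus A') (X_plus A) \<and>
    is_projection_along P (X_minus A') (X_plus A) \<and>
    (\<forall>z\<in>inv_resolvent_set A. G z = Wp z o\<^sub>L Wm z) \<and>
    (\<forall>z\<in>inv_resolvent_set A \<inter> inv_resolvent_set A'.
      is_op_inverse (Wp z) (Wp_inv z) \<and> is_op_inverse (Wm z) (Wm_inv z)) \<and>
    extends_analytically Wp (inv_resolvent_set A) (cball 0 1) \<and>
    extends_analytically Wp_inv (inv_resolvent_set A') (cball 0 1) \<and>
    extends_analytically Wm (inv_resolvent_set A) (- ball 0 1) \<and>
    extends_analytically Wm_inv (inv_resolvent_set A') (- ball 0 1)"
proof -
  let ?Ei = "op_inv (id_blinfun + D)" and ?r = "sup_norm_circle F"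
  have Ei: "?Ei \<in> bounded_ops" by (rule op_inv_bounded_ops[OF inv_ID])
  have A'_ops: "A' \<in> bounded_ops" using ops Ei by (auto simp: A')
  have inv: "op_invertible (id_blinfun - z *\<^sub>C A)" if "norm z = 1" for z
    using op_inv_circle[OF ops(1)] dich that by blast
  have bound: "norm (D + z *\<^sub>C (C o\<^sub>L op_inv (id_blinfun - z *\<^sub>C A) o\<^sub>L B)) \<le> ?r" if "norm z = 1" for z
    unfolding F by (rule transfer_function_le_sup_norm[OF ops(1) inv that])
  \<comment> \<open>On the circle \<open>F z\<close> is a strict contraction, so \<open>G z\<close>
    is invertible and with it \<open>I - zA'\<close>.\<close>
  have "op_invertible (id_blinfun - z *\<^sub>C A')" if "norm z = 1" for z
    unfolding A' using bound[OF that] F_less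
    by (intro closed_loop_invertible ops inv_ID inv that) simp
  then have dich': "dichotomous A'" using op_inv_circle[OF A'_ops] by blast
  obtain Q where Q: "dichotomy_splitting A (riesz_projection A) Q"
    by (rule riesz_projection_splitting[OF ops(1) dich])
  obtain Q' where Q': "dichotomy_splitting A' (riesz_projection A') Q'"
    by (rule riesz_projection_splitting[OF A'_ops dich'])
  interpret open_loop: dichotomy_splitting A "riesz_projection A" Q by (rule Q)
  interpret cl: dichotomy_splitting A' "riesz_projection A'" Q' by (rule Q')
  interpret closed_loop A "riesz_projection A" Q A' "riesz_projection A'" Q' B C D ?r ?Ei
  proof unfold_locales
    show "?Ei (u + D u) = u" "?Ei u + D (?Ei u) = u" for u
      using op_inv_apply[OF inv_ID, of u] by (simp_all add: blinfun.add_left)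
  qed (use ops F_less inv bound in \<open>simp_all add: A' blinfun.diff_left\<close>)
  obtain K where K: "\<And>x. \<exists>y. riesz_projection A' y = 0 \<and> riesz_projection A (x - y) = x - y \<and> norm y \<le> K * norm x"
    by (rule subspaces_span) (rule that)
  obtain Pl where "is_projection_along Pl (X_minus A') (X_plus A)"
    unfolding X_minus_def X_plus_def
    using projection_exists[OF open_loop.P_ops cl.P_ops open_loop.P_P subspaces_inter K] by blast
  \<comment> \<open>A projection is determined by its range and kernel, so the operator
    \<open>P\<close> fixed by description is the \<open>Pl\<close> just obtained.\<close>
  then have proj: "is_projection_along P (X_minus A') (X_plus A)"
    unfolding P using projection_along_eq by metis
  have range_P: "X_plus A = {x. riesz_projection A x = x}"
    unfolding X_plus_def using open_loop.P_P by (auto simp: image_iff) metis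
  have idem: "P (P x) = P x" for x
    using proj unfolding is_projection_along_def by (metis blinfun_apply_blinfun_compose)
  interpret factorization A "riesz_projection A" Q A' "riesz_projection A'" Q' B C D ?r ?Ei P D1 D2 "op_inv D1" "op_inv D2"
  proof unfold_locales
    show "P \<in> bounded_ops" using proj by (simp add: is_projection_along_def)
    show "is_op_inverse D1 (op_inv D1)" "is_op_inverse D2 (op_inv D2)"
      using factors by (simp_all add: is_op_inverse_op_inv)
    show "D1 (D2 u) = u + D u" for u
      using arg_cong[OF factors(5), of "\<lambda>T. blinfun_apply T u"] by (simp add: blinfun.add_left)
    show "riesz_projection A' (P x) = 0" for x
      using proj unfolding is_projection_along_def X_minus_def by blast
    show "riesz_projection A (x - P x) = x - P x" for x
    proof -
      have "P (x - P x) = 0" by (simp add: blinfun.diff_right idem)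
      then have "x - P x \<in> X_plus A" using proj by (auto simp: is_projection_along_def)
      then show ?thesis by (simp add: range_P)
    qed
    show "P x = x" if "riesz_projection A' x = 0" for x
    proof -
      have "x \<in> range P" using that proj by (simp add: is_projection_along_def X_minus_def)
      then show ?thesis using idem by auto
    qed
    show "P x = 0" if "riesz_projection A x = x" for x
      using that proj unfolding is_projection_along_def range_P by blast
  qed (use factors in auto)
  have W: "Wp = local.Wp" "Wm = local.Wm" "Wp_inv = local.Wp_inv" "Wm_inv = local.Wm_inv"
    by (simp_all only: fun_eq_iff Wp Wm Wp_inv Wm_inv Wp_def Wm_def Wp_inv_def Wm_inv_def simp_thms)
  show ?thesis
    unfolding W G F
    using dich' is_projection_along_direct_sum[OF proj] proj Wp_Wm Wp_inverse Wm_inverse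
      Wp_extends Wp_inv_extends Wm_extends Wm_inv_extends
    by (simp add: inv_resolvent_set_def)
qed

end
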